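(* A multiple-conclusion logic $\Vdash$ is finitely based if and only if both $\mathsf{Nmatr}(\Vdash)$ and its complement (the class of $\Sigma$-Nmatrices not in $\mathsf{Nmatr}(\Vdash)$) are closed under ultraproducts.
   Context: Fix a countable signature $\Sigma$ (sets $\Sigma^k$ of $k$-ary connectives), a denumerable set $P$ of variables and the set $Fm$ of formulas. A substitution is a map $\sigma:P\to Fm$ extended homomorphically. A multiple-conclusion logic is a relation $\Vdash\subseteq\wp(Fm)\times\wp(Fm)$ such that for all $\Gamma,\Delta,\Gamma',\Delta'\subseteq Fm$: (O) if $\Gamma\cap\Delta\neq\emptyset$ then $\Gamma\Vdash\Delta$; (D) if $\Gamma\Vdash\Delta$ then $\Gamma\cup\Gamma'\Vdash\Delta\cup\Delta'$; (C) if $\Gamma\cup\Omega\Vdash(Fm\setminus\Omega)\cup\Delta$ for every $\Omega\subseteq Fm$ then $\Gamma\Vdash\Delta$; (S) if $\Gamma\Vdash\Delta$ then $\sigma[\Gamma]\Vdash\sigma[\Delta]$ for every substitution $\sigma$. For a set $R\subseteq\wp(Fm)\times\wp(Fm)$ of rules, $\Vdash_R$ is the smallest multiple-conclusion logic containing $R$; a rule $(\Gamma,\Delta)$ is finite if $\Gamma$ and $\Delta$ are finite; $\Vdash$ is finitely based if $\Vdash=\Vdash_R$ for some finite set $R$ of finite rules. A $\Sigma$-Nmatrix is $\mathbb{M}=\langle A,\cdot_{\mathbb{M}},D\rangle$, each $\copyright\in\Sigma^k$ interpreted as $\copyright_{\mathbb{M}}:A^k\to\wp(A)\setminus\{\emptyset\}$,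 $D\subseteq A$. A valuation is $v:Fm\to A$ with $v(\copyright(\varphi_1,\dots,\varphi_k))\in\copyright_{\mathbb{M}}(v(\varphi_1),\dots,v(\varphi_k))$. $\Gamma\Vdash_{\mathbb{M}}\Delta$ iff every valuation $v$ with $v[\Gamma]\subseteq D$ has $v[\Delta]\cap D\neq\emptyset$. $\mathsf{Nmatr}(\Vdash)$ is the class of $\Sigma$-Nmatrices $\mathbb{M}$ with $\Vdash\subseteq\Vdash_{\mathbb{M}}$. The product of $\mathbb{M}_i=\langle A_i,\cdot_i,D_i\rangle$, $i\in I$, is $\langle\Pi_{i\in I}A_i,\cdot_I,\Pi_{i\in I}D_i\rangle$ with $\copyright_I(s_1,\dots,s_k)=\Pi_{i\in I}\copyright_i(\pi_i(s_1),\dots,\pi_i(s_k))$. The quotient of an Nmatrix $\langle A,\cdot,D\rangle$ by an equivalence $\equiv$ is $\langle A/{\equiv},\cdot_\equiv,\{[x]:x\in D\}\rangle$ with $\copyright_\equiv([x_1],\dots,[x_k])=\{[y]:y\in\copyright(y_1,\dots,y_k),\ y_j\equiv x_j\}$. For an ultrafilter $\mathcal{U}$ on $I$, $s\equiv_{\mathcal{U}}t$ iff $\{i:\pi_i(s)=\pi_i(t)\}\in\mathcal{U}$, and the ultraproduct $\Pi_{\mathcal{U}}\mathbb{M}_i$ is the quotient of the product by $\equiv_{\mathcal{U}}$. A class is closed under ultraproducts if it contains every ultraproduct (over any index set and ultrafilter) of any family of its members. *)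

theory Defs
  imports "HOL-Library.FuncSet" "HOL-Library.Countable_Set"
begin

text \<open>
  A signature is a family \<open>S :: nat \<Rightarrow> 'c set\<close>, where \<open>S k\<close> is the set of \<open>k\<close>-ary connectives. The
  variables are all the elements of the type \<open>'p\<close>. The type \<open>('c, 'p) fm\<close> contains terms that
  do not respect the arities; the formulas over \<open>S\<close> are the elements of \<open>Fm S\<close>.
\<close>

datatype ('c, 'p) fm = Var 'p | App 'c "('c, 'p) fm list"

inductive_set Fm :: "(nat \<Rightarrow> 'c set) \<Rightarrow> ('c, 'p) fm set" for S :: "nat \<Rightarrow> 'c set" where
  Var: "Var p \<in> Fm S"
| App: "c \<in> S (length \<phi>s) \<Longrightarrow> \<forall>\<phi>\<in>set \<phi>s. \<phi> \<in> Fm S \<Longrightarrow> App c \<phi>s \<in> Fm S"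

primrec subst :: "('p \<Rightarrow> ('c, 'p) fm) \<Rightarrow> ('c, 'p) fm \<Rightarrow> ('c, 'p) fm" where
  "subst \<sigma> (Var p) = \<sigma> p"
| "subst \<sigma> (App c \<phi>s) = App c (map (subst \<sigma>) \<phi>s)"

subsection \<open>Multiple-conclusion logics\<close>

type_synonym ('c, 'p) mc_rule = "('c, 'p) fm set \<times> ('c, 'p) fm set"

definition mc_logic :: "(nat \<Rightarrow> 'c set) \<Rightarrow> ('c, 'p) mc_rule set \<Rightarrow> bool" where
  "mc_logic S L \<longleftrightarrow>
     L \<subseteq> Pow (Fm S) \<times> Pow (Fm S) \<and>
     (\<forall>\<Gamma> \<Delta>. \<Gamma> \<subseteq> Fm S \<longrightarrow> \<Delta> \<subseteq> Fm S \<longrightarrow> \<Gamma> \<inter> \<Delta> \<noteq> {} \<longrightarrow> (\<Gamma>, \<Delta>) \<in> L) \<and>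
     (\<forall>\<Gamma> \<Delta> \<Gamma>' \<Delta>'. (\<Gamma>, \<Delta>) \<in> L \<longrightarrow> \<Gamma>' \<subseteq> Fm S \<longrightarrow> \<Delta>' \<subseteq> Fm S \<longrightarrow> (\<Gamma> \<union> \<Gamma>', \<Delta> \<union> \<Delta>') \<in> L) \<and>
     (\<forall>\<Gamma> \<Delta>. \<Gamma> \<subseteq> Fm S \<longrightarrow> \<Delta> \<subseteq> Fm S \<longrightarrow>
        (\<forall>\<Omega>. \<Omega> \<subseteq> Fm S \<longrightarrow> (\<Gamma> \<union> \<Omega>, (Fm S - \<Omega>) \<union> \<Delta>) \<in> L) \<longrightarrow> (\<Gamma>, \<Delta>) \<in> L) \<and>
     (\<forall>\<Gamma> \<Delta> \<sigma>. (\<Gamma>, \<Delta>) \<in> L \<longrightarrow> range \<sigma> \<subseteq> Fm S \<longrightarrow> (subst \<sigma> ` \<Gamma>, subst \<sigma> ` \<Delta>) \<in> L)"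

definition logic_of_rules :: "(nat \<Rightarrow> 'c set) \<Rightarrow> ('c, 'p) mc_rule set \<Rightarrow> ('c, 'p) mc_rule set" where
  "logic_of_rules S R = \<Inter> {L. mc_logic S L \<and> R \<subseteq> L}"

definition finite_rule :: "('c, 'p) mc_rule \<Rightarrow> bool" where
  "finite_rule r \<longleftrightarrow> finite (fst r) \<and> finite (snd r)"

definition finitely_based :: "(nat \<Rightarrow> 'c set) \<Rightarrow> ('c, 'p) mc_rule set \<Rightarrow> bool" where
  "finitely_based S L \<longleftrightarrow>
     (\<exists>R. R \<subseteq> Pow (Fm S) \<times> Pow (Fm S) \<and> finite R \<and> (\<forall>r\<in>R. finite_rule r) \<and>
          L = logic_of_rules S R)"

subsection \<open>Nmatrices\<close>

text \<open>
  The arity of an occurrence of a connective is the length of the argument list. The values of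
  \<open>interp\<close> outside the signature and the set of truth values carry no meaning.
\<close>

record ('c, 'a) nmatrix =
  truth :: "'a set"
  interp :: "'c \<Rightarrow> 'a list \<Rightarrow> 'a set"
  desig :: "'a set"

definition nmatrix :: "(nat \<Rightarrow> 'c set) \<Rightarrow> ('c, 'a) nmatrix \<Rightarrow> bool" where
  "nmatrix S M \<longleftrightarrow>
     desig M \<subseteq> truth M \<and>
     (\<forall>c xs. c \<in> S (length xs) \<longrightarrow> set xs \<subseteq> truth M \<longrightarrow>
        interp M c xs \<subseteq> truth M \<and> interp M c xs \<noteq> {})"

definition valuation ::
    "(nat \<Rightarrow> 'c set) \<Rightarrow> ('c, 'a) nmatrix \<Rightarrow> (('c, 'p) fm \<Rightarrow> 'a) \<Rightarrow> bool" where
  "valuation S M v \<longleftrightarrow>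
     v \<in> Fm S \<rightarrow> truth M \<and>
     (\<forall>c \<phi>s. c \<in> S (length \<phi>s) \<longrightarrow> set \<phi>s \<subseteq> Fm S \<longrightarrow> v (App c \<phi>s) \<in> interp M c (map v \<phi>s))"

definition logic_of_nmatrix :: "(nat \<Rightarrow> 'c set) \<Rightarrow> ('c, 'a) nmatrix \<Rightarrow> ('c, 'p) mc_rule set" where
  "logic_of_nmatrix S M =
     {(\<Gamma>, \<Delta>). \<Gamma> \<subseteq> Fm S \<and> \<Delta> \<subseteq> Fm S \<and>
        (\<forall>v. valuation S M v \<longrightarrow> v ` \<Gamma> \<subseteq> desig M \<longrightarrow> v ` \<Delta> \<inter> desig M \<noteq> {})}"

definition Nmatr :: "(nat \<Rightarrow> 'c set) \<Rightarrow> ('c, 'p) mc_rule set \<Rightarrow> ('c, 'a) nmatrix set" where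
  "Nmatr S L = {M. nmatrix S M \<and> L \<subseteq> logic_of_nmatrix S M}"

definition co_Nmatr :: "(nat \<Rightarrow> 'c set) \<Rightarrow> ('c, 'p) mc_rule set \<Rightarrow> ('c, 'a) nmatrix set" where
  "co_Nmatr S L = {M. nmatrix S M} - Nmatr S L"

subsection \<open>Ultraproducts\<close>

definition ultrafilter_on :: "'i set \<Rightarrow> 'i set set \<Rightarrow> bool" where
  "ultrafilter_on I U \<longleftrightarrow>
     U \<subseteq> Pow I \<and> I \<in> U \<and> {} \<notin> U \<and>
     (\<forall>X\<in>U. \<forall>Y\<in>U. X \<inter> Y \<in> U) \<and>
     (\<forall>X\<in>U. \<forall>Y. X \<subseteq> Y \<longrightarrow> Y \<subseteq> I \<longrightarrow> Y \<in> U) \<and>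
     (\<forall>X. X \<subseteq> I \<longrightarrow> X \<in> U \<or> I - X \<in> U)"

definition nm_product :: "'i set \<Rightarrow> ('i \<Rightarrow> ('c, 'a) nmatrix) \<Rightarrow> ('c, 'i \<Rightarrow> 'a) nmatrix" where
  "nm_product I M =
     \<lparr>truth = (\<Pi>\<^sub>E i\<in>I. truth (M i)),
      interp = (\<lambda>c ss. \<Pi>\<^sub>E i\<in>I. interp (M i) c (map (\<lambda>s. s i) ss)),
      desig = (\<Pi>\<^sub>E i\<in>I. desig (M i))\<rparr>"

text \<open>
  An argument list \<open>Xs\<close> of the quotient consists of equivalence classes \<open>[x\<^sub>j]\<close>, so that
  \<open>y\<^sub>j \<equiv> x\<^sub>j\<close> is membership of \<open>y\<^sub>j\<close> in the \<open>j\<close>-th element of \<open>Xs\<close>.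
\<close>

definition nm_quotient :: "('c, 'a) nmatrix \<Rightarrow> ('a \<times> 'a) set \<Rightarrow> ('c, 'a set) nmatrix" where
  "nm_quotient M E =
     \<lparr>truth = truth M // E,
      interp = (\<lambda>c Xs. {E `` {y} | y ys. list_all2 (\<in>) ys Xs \<and> y \<in> interp M c ys}),
      desig = {E `` {x} | x. x \<in> desig M}\<rparr>"

definition ultra_equiv ::
    "'i set \<Rightarrow> 'i set set \<Rightarrow> ('i \<Rightarrow> ('c, 'a) nmatrix) \<Rightarrow> (('i \<Rightarrow> 'a) \<times> ('i \<Rightarrow> 'a)) set" where
  "ultra_equiv I U M =
     {(s, t). s \<in> truth (nm_product I M) \<and> t \<in> truth (nm_product I M) \<and> {i \<in> I. s i = t i} \<in> U}"

definition ultraproduct ::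
    "'i set \<Rightarrow> 'i set set \<Rightarrow> ('i \<Rightarrow> ('c, 'a) nmatrix) \<Rightarrow> ('c, ('i \<Rightarrow> 'a) set) nmatrix" where
  "ultraproduct I U M = nm_quotient (nm_product I M) (ultra_equiv I U M)"

text \<open>
  Ultraproducts of Nmatrices over \<open>'a\<close> with index sets over \<open>'i\<close> have their truth values in
  \<open>('i \<Rightarrow> 'a) set\<close>, so a class of Nmatrices enters through its instances \<open>K\<close> and \<open>K'\<close> at these
  two types.
\<close>

definition closed_under_ultraproducts ::
    "('c, 'a) nmatrix set \<Rightarrow> ('c, ('i \<Rightarrow> 'a) set) nmatrix set \<Rightarrow> bool" where
  "closed_under_ultraproducts K K' \<longleftrightarrow>
     (\<forall>(I :: 'i set) U M. ultrafilter_on I U \<longrightarrow> (\<forall>i\<in>I. M i \<in> K) \<longrightarrow> ultraproduct I U M \<in> K')"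

end

theory Submission
  imports Defs
begin

text \<open>
  Truth of a finite rule in an Nmatrix is a first-order property, since every partial valuation
  on a set of formulas closed under subformulas extends to a valuation; hence it passes to and
  from ultraproducts, which gives one direction.

  Conversely, every logic is complete for countable Nmatrices (Lindenbaum matrices). If the
  models of \<open>L\<close> are closed under ultraproducts, then \<open>L\<close> is finitary: otherwise countermodels to
  the finite parts of a valid rule would have an ultraproduct refuting it. So \<open>L\<close> is generated
  by an enumeration \<open>r\<^sub>0, r\<^sub>1, \<dots>\<close> of its finite rules. If no finite part generates \<open>L\<close>, take models
  of \<open>r\<^sub>0, \<dots>, r\<^sub>n\<close> outside \<open>Nmatr S L\<close>; their ultraproduct along a nonprincipal ultrafilter
  satisfies every \<open>r\<^sub>k\<close>, contradicting the closure of the complement.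
\<close>

section \<open>Formulas\<close>

instance fm :: (countable, countable) countable
  by countable_datatype

lemma set1_fm_Fm: "\<phi> \<in> Fm S \<Longrightarrow> set1_fm \<phi> \<subseteq> (\<Union>k. S k)"
  by (induction rule: Fm.induct) auto

text \<open>The type \<open>'c\<close> itself may be uncountable. But a formula over
  \<open>S\<close> mentions only connectives of the signature, so numbering these and the variables
  embeds \<open>Fm S\<close> into the countable type \<open>(nat, nat) fm\<close>.\<close>

lemma countable_Fm:
  fixes S :: "nat \<Rightarrow> 'c set"
  assumes "\<forall>k. countable (S k)" and "countable (UNIV :: 'p set)"
  shows "countable (Fm S :: ('c, 'p) fm set)"
proof -
  let ?C = "\<Union>k. S k"
  let ?f = "map_fm (to_nat_on ?C) (to_nat_on (UNIV :: 'p set)) :: ('c, 'p) fm \<Rightarrow> (nat, nat) fm"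
  have C: "countable ?C" using assms(1) by simp
  have "inj_on ?f (Fm S)"
  proof (rule inj_onI)
    fix \<phi> \<psi> :: "('c, 'p) fm"
    assume "\<phi> \<in> Fm S" "\<psi> \<in> Fm S" and eq: "?f \<phi> = ?f \<psi>"
    then have sub: "set1_fm \<phi> \<subseteq> ?C" "set1_fm \<psi> \<subseteq> ?C" by (auto dest!: set1_fm_Fm)
    show "\<phi> = \<psi>"
    proof (rule fm.inj_map_strong[OF _ _ eq])
      fix z za :: 'c assume "z \<in> set1_fm \<phi>" "za \<in> set1_fm \<psi>" "to_nat_on ?C z = to_nat_on ?C za"
      with sub show "z = za" using inj_on_to_nat_on[OF C] by (meson inj_onD subsetD)
    next
      fix z za :: 'p assume "to_nat_on (UNIV :: 'p set) z = to_nat_on UNIV za"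
      then show "z = za" using inj_on_to_nat_on[OF assms(2)] by (meson inj_onD UNIV_I)
    qed
  qed
  then show ?thesis by (rule countable_image_inj_on[rotated]) simp
qed

lemma Fm_AppD: "App c \<phi>s \<in> Fm S \<Longrightarrow> c \<in> S (length \<phi>s) \<and> set \<phi>s \<subseteq> Fm S"
  by (auto elim: Fm.cases)

lemma subst_in_Fm: "\<phi> \<in> Fm S \<Longrightarrow> range \<sigma> \<subseteq> Fm S \<Longrightarrow> subst \<sigma> \<phi> \<in> Fm S"
  by (induction rule: Fm.induct) (auto intro!: Fm.App)

text \<open>Supplies the finite sets closed under arguments on which partial valuations
  live.\<close>

primrec subfm :: "('c, 'p) fm \<Rightarrow> ('c, 'p) fm set" where
  "subfm (Var p) = {Var p}"
| "subfm (App c \<phi>s) = insert (App c \<phi>s) (\<Union> (set (map subfm \<phi>s)))"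

lemma finite_subfm: "finite (subfm \<phi>)"
  by (induction \<phi>) auto

lemma subfm_refl: "\<phi> \<in> subfm \<phi>"
  by (cases \<phi>) auto

lemma subfm_App_closed: "App c \<phi>s \<in> subfm \<phi> \<Longrightarrow> set \<phi>s \<subseteq> subfm \<phi>"
  by (induction \<phi>) (auto simp: subfm_refl)

lemma subfm_subset_Fm: "\<phi> \<in> Fm S \<Longrightarrow> subfm \<phi> \<subseteq> Fm S"
  by (induction rule: Fm.induct) (auto intro: Fm.intros)

section \<open>Valuations\<close>

text \<open>An Nmatrix constrains a compound only through the values of its arguments, so the values
  outside \<open>T\<close> can be chosen by recursion on formulas.\<close>

primrec extend_val ::
    "('c, 'a) nmatrix \<Rightarrow> ('c, 'p) fm set \<Rightarrow> (('c, 'p) fm \<Rightarrow> 'a) \<Rightarrow> ('c, 'p) fm \<Rightarrow> 'a" where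
  "extend_val M T w (Var p) = (if Var p \<in> T then w (Var p) else (SOME x. x \<in> truth M))"
| "extend_val M T w (App c \<phi>s) =
     (if App c \<phi>s \<in> T then w (App c \<phi>s)
      else (SOME x. x \<in> interp M c (map (extend_val M T w) \<phi>s)))"

lemma extend_val_eq: "\<phi> \<in> T \<Longrightarrow> extend_val M T w \<phi> = w \<phi>"
  by (cases \<phi>) auto

text \<open>Since \<open>T\<close> is closed under arguments, a compound in \<open>T\<close> sees
  only values of \<open>w\<close>, which satisfy the interpretation by \<open>wI\<close>. A compound
  outside \<open>T\<close> finds a nonempty set of admissible values.\<close>

lemma valuation_extend_val:
  assumes M: "nmatrix S M" and ne: "truth M \<noteq> {}"
    and w: "\<And>\<phi>. \<phi> \<in> T \<Longrightarrow> w \<phi> \<in> truth M"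
    and closed: "\<And>c \<phi>s. App c \<phi>s \<in> T \<Longrightarrow> set \<phi>s \<subseteq> T"
    and wI: "\<And>c \<phi>s. App c \<phi>s \<in> T \<Longrightarrow> w (App c \<phi>s) \<in> interp M c (map w \<phi>s)"
  shows "valuation S M (extend_val M T w)"
proof -
  let ?v = "extend_val M T w"
  \<comment> \<open>That the arguments take truth values is a premise here, so that the fact serves
    both inside the induction for \<open>tr\<close> and after it.\<close>
  have step: "?v (App c \<phi>s) \<in> interp M c (map ?v \<phi>s)"
    if c: "c \<in> S (length \<phi>s)" and t: "\<forall>\<phi>\<in>set \<phi>s. ?v \<phi> \<in> truth M" for c \<phi>s
  proof (cases "App c \<phi>s \<in> T")
    case True
    then have "map ?v \<phi>s = map w \<phi>s" using closed[OF True] by (auto simp: extend_val_eq)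
    then show ?thesis using True wI[OF True] by (simp del: map_eq_conv)
  next
    case False
    have "interp M c (map ?v \<phi>s) \<noteq> {}"
      using M c t unfolding nmatrix_def by (metis (no_types, lifting) image_subsetI length_map list.set_map)
    then show ?thesis using False by (auto simp: some_in_eq)
  qed
  have tr: "?v \<phi> \<in> truth M" if "\<phi> \<in> Fm S" for \<phi>
    using that
  proof (induction rule: Fm.induct)
    case (Var p)
    then show ?case using ne w by (auto simp: some_in_eq)
  next
    case (App c \<phi>s)
    have "interp M c (map ?v \<phi>s) \<subseteq> truth M"
      using M App unfolding nmatrix_def by (metis (no_types, lifting) image_subsetI length_map list.set_map)
    then show ?case using step[of c \<phi>s] App by blast
  qed
  show ?thesis unfolding valuation_def using tr step by (meson Pi_I subsetD)
qed

lemma valuation_exists: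
  assumes "nmatrix S M" and "truth M \<noteq> {}"
  obtains v where "valuation S M v"
  using valuation_extend_val[OF assms, of "{}"] by auto

lemma valuation_subst:
  assumes v: "valuation S M v" and \<sigma>: "range \<sigma> \<subseteq> Fm S"
  shows "valuation S M (v \<circ> subst \<sigma>)"
proof -
  have "v (subst \<sigma> (App c \<phi>s)) \<in> interp M c (map (v \<circ> subst \<sigma>) \<phi>s)"
    if "c \<in> S (length \<phi>s)" "set \<phi>s \<subseteq> Fm S" for c \<phi>s
  proof -
    have "set (map (subst \<sigma>) \<phi>s) \<subseteq> Fm S" using that \<sigma> by (auto intro: subst_in_Fm)
    then have "v (App c (map (subst \<sigma>) \<phi>s)) \<in> interp M c (map v (map (subst \<sigma>) \<phi>s))"
      using v that(1) unfolding valuation_def by (simp del: map_map)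
    then show ?thesis by simp
  qed
  then show ?thesis using v \<sigma> unfolding valuation_def by (auto intro: subst_in_Fm)
qed

section \<open>Logics\<close>

lemma mc_logic_subset:
  assumes "mc_logic S L"
  shows "L \<subseteq> Pow (Fm S) \<times> Pow (Fm S)"
  using assms unfolding mc_logic_def by (elim conjE)

lemma mc_logic_overlap:
  assumes "mc_logic S L" "\<Gamma> \<subseteq> Fm S" "\<Delta> \<subseteq> Fm S" "\<Gamma> \<inter> \<Delta> \<noteq> {}"
  shows "(\<Gamma>, \<Delta>) \<in> L"
proof -
  have "\<forall>\<Gamma> \<Delta>. \<Gamma> \<subseteq> Fm S \<longrightarrow> \<Delta> \<subseteq> Fm S \<longrightarrow> \<Gamma> \<inter> \<Delta> \<noteq> {} \<longrightarrow> (\<Gamma>, \<Delta>) \<in> L"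
    using assms(1) unfolding mc_logic_def by (elim conjE)
  then show ?thesis using assms(2-) by simp
qed

lemma mc_logic_dilute:
  assumes "mc_logic S L" "(\<Gamma>, \<Delta>) \<in> L" "\<Gamma> \<subseteq> \<Gamma>'" "\<Delta> \<subseteq> \<Delta>'" "\<Gamma>' \<subseteq> Fm S" "\<Delta>' \<subseteq> Fm S"
  shows "(\<Gamma>', \<Delta>') \<in> L"
proof -
  have "\<forall>\<Gamma> \<Delta> \<Gamma>' \<Delta>'. (\<Gamma>, \<Delta>) \<in> L \<longrightarrow> \<Gamma>' \<subseteq> Fm S \<longrightarrow> \<Delta>' \<subseteq> Fm S \<longrightarrow>
      (\<Gamma> \<union> \<Gamma>', \<Delta> \<union> \<Delta>') \<in> L"
    using assms(1) unfolding mc_logic_def by (elim conjE)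
  then have "(\<Gamma> \<union> \<Gamma>', \<Delta> \<union> \<Delta>') \<in> L" using assms(2,5,6) by simp
  then show ?thesis using assms(3,4) by (simp add: Un_absorb1)
qed

text \<open>This contraposed cut condition takes the place of Lindenbaum's lemma: the partition of
  \<open>Fm S\<close> by \<open>\<Omega>\<close> later separates designated from undesignated
  formulas.\<close>

lemma mc_logic_cut:
  assumes "mc_logic S L" "\<Gamma> \<subseteq> Fm S" "\<Delta> \<subseteq> Fm S" "(\<Gamma>, \<Delta>) \<notin> L"
  obtains \<Omega> where "\<Omega> \<subseteq> Fm S" "(\<Gamma> \<union> \<Omega>, (Fm S - \<Omega>) \<union> \<Delta>) \<notin> L"
proof -
  have "\<forall>\<Gamma> \<Delta>. \<Gamma> \<subseteq> Fm S \<longrightarrow> \<Delta> \<subseteq> Fm S \<longrightarrow>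
      (\<forall>\<Omega>. \<Omega> \<subseteq> Fm S \<longrightarrow> (\<Gamma> \<union> \<Omega>, (Fm S - \<Omega>) \<union> \<Delta>) \<in> L) \<longrightarrow> (\<Gamma>, \<Delta>) \<in> L"
    using assms(1) unfolding mc_logic_def by (elim conjE)
  then show thesis using assms(2-) that by meson
qed

lemma mc_logic_subst:
  assumes "mc_logic S L" "(\<Gamma>, \<Delta>) \<in> L" "range \<sigma> \<subseteq> Fm S"
  shows "(subst \<sigma> ` \<Gamma>, subst \<sigma> ` \<Delta>) \<in> L"
proof -
  have "\<forall>\<Gamma> \<Delta> \<sigma>. (\<Gamma>, \<Delta>) \<in> L \<longrightarrow> range \<sigma> \<subseteq> Fm S \<longrightarrow> (subst \<sigma> ` \<Gamma>, subst \<sigma> ` \<Delta>) \<in> L"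
    using assms(1) unfolding mc_logic_def by (elim conjE)
  then show ?thesis using assms(2-) by simp
qed

lemma mc_logic_full:
  "mc_logic S (Pow (Fm S) \<times> Pow (Fm S) :: ('c, 'p) mc_rule set)"
  unfolding mc_logic_def mem_Times_iff fst_conv snd_conv Pow_iff
proof (intro conjI allI impI)
  fix \<Gamma> \<Delta> :: "('c, 'p) fm set" and \<sigma> :: "'p \<Rightarrow> ('c, 'p) fm"
  assume "\<Gamma> \<subseteq> Fm S \<and> \<Delta> \<subseteq> Fm S" and \<sigma>: "range \<sigma> \<subseteq> Fm S"
  then show "subst \<sigma> ` \<Gamma> \<subseteq> Fm S" "subst \<sigma> ` \<Delta> \<subseteq> Fm S"
    using subst_in_Fm[OF _ \<sigma>] by blast+
qed blast+

text \<open>Each closure condition passes to intersections. The greatest logic belongs to the family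
  \<open>?X\<close>, so the intersection is not \<open>UNIV\<close> but consists of rules over
  \<open>Fm S\<close>.\<close>

lemma mc_logic_logic_of_rules:
  fixes R :: "('c, 'p) mc_rule set"
  assumes "R \<subseteq> Pow (Fm S) \<times> Pow (Fm S)"
  shows "mc_logic S (logic_of_rules S R)"
proof -
  let ?X = "{L. mc_logic S L \<and> R \<subseteq> L}"
  have full: "Pow (Fm S) \<times> Pow (Fm S) \<in> ?X" using assms mc_logic_full by blast
  show ?thesis
    unfolding logic_of_rules_def mc_logic_def[of S "\<Inter> ?X"]
  proof (intro conjI allI impI)
    show "\<Inter> ?X \<subseteq> Pow (Fm S) \<times> Pow (Fm S)" using full by blast
  next
    fix \<Gamma> \<Delta> :: "('c, 'p) fm set" assume "\<Gamma> \<subseteq> Fm S" "\<Delta> \<subseteq> Fm S" "\<Gamma> \<inter> \<Delta> \<noteq> {}"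
    then show "(\<Gamma>, \<Delta>) \<in> \<Inter> ?X" by (auto intro: mc_logic_overlap)
  next
    fix \<Gamma> \<Delta> \<Gamma>' \<Delta>' :: "('c, 'p) fm set"
    assume *: "(\<Gamma>, \<Delta>) \<in> \<Inter> ?X" "\<Gamma>' \<subseteq> Fm S" "\<Delta>' \<subseteq> Fm S"
    show "(\<Gamma> \<union> \<Gamma>', \<Delta> \<union> \<Delta>') \<in> \<Inter> ?X"
    proof (rule InterI)
      fix L assume L: "L \<in> ?X"
      then have "(\<Gamma>, \<Delta>) \<in> L" "mc_logic S L" using *(1) by blast+
      moreover from this have "\<Gamma> \<subseteq> Fm S" "\<Delta> \<subseteq> Fm S" using mc_logic_subset by blast+
      ultimately show "(\<Gamma> \<union> \<Gamma>', \<Delta> \<union> \<Delta>') \<in> L" using *(2,3) by (auto intro: mc_logic_dilute)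
    qed
  next
    fix \<Gamma> \<Delta> :: "('c, 'p) fm set"
    assume *: "\<Gamma> \<subseteq> Fm S" "\<Delta> \<subseteq> Fm S"
      "\<forall>\<Omega>. \<Omega> \<subseteq> Fm S \<longrightarrow> (\<Gamma> \<union> \<Omega>, (Fm S - \<Omega>) \<union> \<Delta>) \<in> \<Inter> ?X"
    show "(\<Gamma>, \<Delta>) \<in> \<Inter> ?X"
    proof (rule InterI, rule ccontr)
      fix L assume L: "L \<in> ?X" and n: "(\<Gamma>, \<Delta>) \<notin> L"
      have "mc_logic S L" using L by simp
      from mc_logic_cut[OF this *(1,2) n] obtain \<Omega>
        where \<Omega>: "\<Omega> \<subseteq> Fm S" "(\<Gamma> \<union> \<Omega>, (Fm S - \<Omega>) \<union> \<Delta>) \<notin> L" .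
      have "(\<Gamma> \<union> \<Omega>, (Fm S - \<Omega>) \<union> \<Delta>) \<in> \<Inter> ?X" using *(3) \<Omega>(1) by simp
      then show False using L \<Omega>(2) by blast
    qed
  next
    fix \<Gamma> \<Delta> and \<sigma> :: "'p \<Rightarrow> ('c, 'p) fm"
    assume "(\<Gamma>, \<Delta>) \<in> \<Inter> ?X" "range \<sigma> \<subseteq> Fm S"
    then show "(subst \<sigma> ` \<Gamma>, subst \<sigma> ` \<Delta>) \<in> \<Inter> ?X" by (auto intro: mc_logic_subst)
  qed
qed

lemma rules_subset_logic_of_rules: "R \<subseteq> logic_of_rules S R"
  unfolding logic_of_rules_def by blast

lemma logic_of_rules_least: "mc_logic S L \<Longrightarrow> R \<subseteq> L \<Longrightarrow> logic_of_rules S R \<subseteq> L"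
  unfolding logic_of_rules_def by blast

section \<open>Consequence in an Nmatrix and completeness\<close>

lemma logic_of_nmatrix_iff:
  "(\<Gamma>, \<Delta>) \<in> logic_of_nmatrix S M \<longleftrightarrow> \<Gamma> \<subseteq> Fm S \<and> \<Delta> \<subseteq> Fm S \<and>
     (\<forall>v. valuation S M v \<longrightarrow> (\<forall>\<phi>\<in>\<Gamma>. v \<phi> \<in> desig M) \<longrightarrow> (\<exists>\<phi>\<in>\<Delta>. v \<phi> \<in> desig M))"
  unfolding logic_of_nmatrix_def by (simp add: image_subset_iff disjoint_iff)

lemma logic_of_nmatrixD:
  assumes "(\<Gamma>, \<Delta>) \<in> logic_of_nmatrix S M" "valuation S M v" "\<forall>\<phi>\<in>\<Gamma>. v \<phi> \<in> desig M"
  shows "\<exists>\<phi>\<in>\<Delta>. v \<phi> \<in> desig M"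
  using assms unfolding logic_of_nmatrix_iff by iprover

lemma not_in_logic_of_nmatrixE:
  assumes "(\<Gamma>, \<Delta>) \<notin> logic_of_nmatrix S M" "\<Gamma> \<subseteq> Fm S" "\<Delta> \<subseteq> Fm S"
  obtains v where "valuation S M v" "\<forall>\<phi>\<in>\<Gamma>. v \<phi> \<in> desig M" "\<forall>\<phi>\<in>\<Delta>. v \<phi> \<notin> desig M"
proof -
  have "\<exists>v. valuation S M v \<and> (\<forall>\<phi>\<in>\<Gamma>. v \<phi> \<in> desig M) \<and> (\<forall>\<phi>\<in>\<Delta>. v \<phi> \<notin> desig M)"
    using assms by (simp add: logic_of_nmatrix_iff)
  with that show thesis by blast
qed

lemma mc_logic_logic_of_nmatrix:
  "mc_logic S (logic_of_nmatrix S M :: ('c, 'p) mc_rule set)"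
  unfolding mc_logic_def
proof (intro conjI allI impI)
  show "logic_of_nmatrix S M \<subseteq> Pow (Fm S) \<times> Pow (Fm S)"
    unfolding logic_of_nmatrix_def by blast
next
  fix \<Gamma> \<Delta> :: "('c, 'p) fm set" assume "\<Gamma> \<subseteq> Fm S" "\<Delta> \<subseteq> Fm S" "\<Gamma> \<inter> \<Delta> \<noteq> {}"
  then show "(\<Gamma>, \<Delta>) \<in> logic_of_nmatrix S M" unfolding logic_of_nmatrix_iff by blast
next
  fix \<Gamma> \<Delta> \<Gamma>' \<Delta>' :: "('c, 'p) fm set"
  assume *: "(\<Gamma>, \<Delta>) \<in> logic_of_nmatrix S M" "\<Gamma>' \<subseteq> Fm S" "\<Delta>' \<subseteq> Fm S"
  show "(\<Gamma> \<union> \<Gamma>', \<Delta> \<union> \<Delta>') \<in> logic_of_nmatrix S M"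
    unfolding logic_of_nmatrix_iff
  proof (intro conjI allI impI)
    fix v assume "valuation S M v" "\<forall>\<phi>\<in>\<Gamma> \<union> \<Gamma>'. v \<phi> \<in> desig M"
    then show "\<exists>\<phi>\<in>\<Delta> \<union> \<Delta>'. v \<phi> \<in> desig M" using *(1) unfolding logic_of_nmatrix_iff by blast
  qed (use * in \<open>auto simp: logic_of_nmatrix_iff\<close>)
next
  fix \<Gamma> \<Delta> :: "('c, 'p) fm set"
  assume *: "\<Gamma> \<subseteq> Fm S" "\<Delta> \<subseteq> Fm S"
    "\<forall>\<Omega>. \<Omega> \<subseteq> Fm S \<longrightarrow> (\<Gamma> \<union> \<Omega>, (Fm S - \<Omega>) \<union> \<Delta>) \<in> logic_of_nmatrix S M"
  show "(\<Gamma>, \<Delta>) \<in> logic_of_nmatrix S M"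
    unfolding logic_of_nmatrix_iff
  proof (intro conjI allI impI)
    fix v :: "('c, 'p) fm \<Rightarrow> _" assume v: "valuation S M v" "\<forall>\<phi>\<in>\<Gamma>. v \<phi> \<in> desig M"
    \<comment> \<open>Cut is applied to the set of formulas that \<open>v\<close> designates:
      \<open>v\<close> satisfies the enlarged left side and fails on all of
      \<open>Fm S - ?\<Omega>\<close>, so it must designate a member of
      \<open>\<Delta>\<close>.\<close>
    let ?\<Omega> = "{\<phi> \<in> Fm S. v \<phi> \<in> desig M}"
    have "(\<Gamma> \<union> ?\<Omega>, (Fm S - ?\<Omega>) \<union> \<Delta>) \<in> logic_of_nmatrix S M" using *(3) by simp
    moreover have "\<forall>\<phi>\<in>\<Gamma> \<union> ?\<Omega>. v \<phi> \<in> desig M" using v(2) by blast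
    ultimately have "\<exists>\<phi>\<in>(Fm S - ?\<Omega>) \<union> \<Delta>. v \<phi> \<in> desig M"
      using v(1) unfolding logic_of_nmatrix_iff by iprover
    then show "\<exists>\<phi>\<in>\<Delta>. v \<phi> \<in> desig M" by blast
  qed (use * in auto)
next
  fix \<Gamma> \<Delta> :: "('c, 'p) fm set" and \<sigma> :: "'p \<Rightarrow> ('c, 'p) fm"
  assume *: "(\<Gamma>, \<Delta>) \<in> logic_of_nmatrix S M" and \<sigma>: "range \<sigma> \<subseteq> Fm S"
  have sub: "\<Gamma> \<subseteq> Fm S" "\<Delta> \<subseteq> Fm S" using * unfolding logic_of_nmatrix_iff by auto
  show "(subst \<sigma> ` \<Gamma>, subst \<sigma> ` \<Delta>) \<in> logic_of_nmatrix S M"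
    unfolding logic_of_nmatrix_iff
  proof (intro conjI allI impI)
    show "subst \<sigma> ` \<Gamma> \<subseteq> Fm S" "subst \<sigma> ` \<Delta> \<subseteq> Fm S"
      using sub subst_in_Fm[OF _ \<sigma>] by blast+
    fix v :: "('c, 'p) fm \<Rightarrow> _"
    assume v: "valuation S M v" "\<forall>\<phi>\<in>subst \<sigma> ` \<Gamma>. v \<phi> \<in> desig M"
    then have "\<forall>\<phi>\<in>\<Gamma>. (v \<circ> subst \<sigma>) \<phi> \<in> desig M" by simp
    then have "\<exists>\<phi>\<in>\<Delta>. (v \<circ> subst \<sigma>) \<phi> \<in> desig M"
      by (rule logic_of_nmatrixD[OF * valuation_subst[OF v(1) \<sigma>]])
    then show "\<exists>\<phi>\<in>subst \<sigma> ` \<Delta>. v \<phi> \<in> desig M" by simp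
  qed
qed

text \<open>The logic of \<open>M\<close> is itself a multiple-conclusion logic, so it contains the
  least one over \<open>R\<close> as soon as it contains \<open>R\<close>. Membership can thus be
  tested on the base alone.\<close>

lemma Nmatr_logic_of_rules:
  "M \<in> Nmatr S (logic_of_rules S R) \<longleftrightarrow> nmatrix S M \<and> R \<subseteq> logic_of_nmatrix S M"
  unfolding Nmatr_def
  using rules_subset_logic_of_rules logic_of_rules_least[OF mc_logic_logic_of_nmatrix]
  by (metis (no_types, lifting) dual_order.trans mem_Collect_eq)

text \<open>The countermodel is the deterministic matrix of all formulas, designating a maximal
  theory \<open>\<Omega>\<close> obtained from the cut property; its valuations are the substitutions.\<close>

lemma Nmatr_complete:
  fixes S :: "nat \<Rightarrow> 'c set" and L :: "('c, 'p) mc_rule set"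
  assumes L: "mc_logic S L" and sub: "\<Gamma> \<subseteq> Fm S" "\<Delta> \<subseteq> Fm S" and nL: "(\<Gamma>, \<Delta>) \<notin> L"
    and count: "countable (Fm S :: ('c, 'p) fm set)" and inf: "infinite (UNIV :: 'a set)"
  obtains M :: "('c, 'a) nmatrix" where "M \<in> Nmatr S L" "(\<Gamma>, \<Delta>) \<notin> logic_of_nmatrix S M"
proof -
  obtain f :: "nat \<Rightarrow> 'a" where f: "inj f" using infinite_countable_subset[OF inf] by blast
  \<comment> \<open>The truth values have to lie in the given type \<open>'a\<close>, so formulas
    are coded there by \<open>e\<close> and decoded by \<open>d\<close>.\<close>
  define e :: "('c, 'p) fm \<Rightarrow> 'a" where "e = f \<circ> to_nat_on (Fm S)"
  have e: "inj_on e (Fm S)" unfolding e_def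
    using comp_inj_on inj_on_to_nat_on[OF count] f inj_on_subset by blast
  define d where "d = inv_into (Fm S) e"
  have de: "d (e \<phi>) = \<phi>" if "\<phi> \<in> Fm S" for \<phi> using that e by (simp add: d_def)
  have dF: "d x \<in> Fm S" and ed: "e (d x) = x" if "x \<in> e ` Fm S" for x
    using that by (auto simp: d_def inv_into_into f_inv_into_f)
  obtain \<Omega> where \<Omega>: "\<Omega> \<subseteq> Fm S" and n\<Omega>: "(\<Gamma> \<union> \<Omega>, (Fm S - \<Omega>) \<union> \<Delta>) \<notin> L"
    using mc_logic_cut[OF L sub nL] by blast
  \<comment> \<open>An overlap of the two sides would put the rule into \<open>L\<close>; hence
    \<open>\<Gamma>\<close> lies inside \<open>\<Omega>\<close> and \<open>\<Delta>\<close>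
    outside.\<close>
  have "(\<Gamma> \<union> \<Omega>) \<inter> ((Fm S - \<Omega>) \<union> \<Delta>) = {}"
    using mc_logic_overlap[OF L, of "\<Gamma> \<union> \<Omega>" "(Fm S - \<Omega>) \<union> \<Delta>"] n\<Omega> \<Omega> sub by blast
  then have G: "\<Gamma> \<subseteq> \<Omega>" and D: "\<Delta> \<inter> \<Omega> = {}" using sub by auto
  define M :: "('c, 'a) nmatrix" where
    "M = \<lparr>truth = e ` Fm S, interp = (\<lambda>c xs. {e (App c (map d xs))}), desig = e ` \<Omega>\<rparr>"
  have des: "e \<phi> \<in> desig M \<longleftrightarrow> \<phi> \<in> \<Omega>" if "\<phi> \<in> Fm S" for \<phi>
    using that \<Omega> e by (auto simp: M_def dest: inj_onD)
  have nm: "nmatrix S M"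
    unfolding nmatrix_def M_def using \<Omega> dF by (force intro!: Fm.App)
  have "(\<Gamma>', \<Delta>') \<in> logic_of_nmatrix S M" if r: "(\<Gamma>', \<Delta>') \<in> L" for \<Gamma>' \<Delta>'
    unfolding logic_of_nmatrix_iff
  proof (intro conjI allI impI)
    show sub': "\<Gamma>' \<subseteq> Fm S" "\<Delta>' \<subseteq> Fm S" using r mc_logic_subset[OF L] by auto
    fix v :: "('c, 'p) fm \<Rightarrow> 'a" assume v: "valuation S M v" "\<forall>\<phi>\<in>\<Gamma>'. v \<phi> \<in> desig M"
    define \<sigma> where "\<sigma> p = d (v (Var p))" for p
    have vt: "v \<phi> \<in> e ` Fm S" if "\<phi> \<in> Fm S" for \<phi>
      using v(1) that unfolding valuation_def M_def by auto
    have \<sigma>: "range \<sigma> \<subseteq> Fm S" unfolding \<sigma>_def by (auto intro!: dF vt Fm.Var)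
    have vs: "v \<phi> = e (subst \<sigma> \<phi>)" if "\<phi> \<in> Fm S" for \<phi>
      using that
    proof (induction rule: Fm.induct)
      case (Var p)
      show ?case using ed[OF vt[OF Fm.Var]] by (simp add: \<sigma>_def)
    next
      case (App c \<phi>s)
      then have "v (App c \<phi>s) \<in> interp M c (map v \<phi>s)"
        using v(1) unfolding valuation_def by blast
      then have "v (App c \<phi>s) = e (App c (map d (map v \<phi>s)))" by (simp add: M_def)
      moreover have "map d (map v \<phi>s) = map (subst \<sigma>) \<phi>s"
        using App \<sigma> by (auto simp: de subst_in_Fm)
      ultimately show ?case by (simp only: subst.simps)
    qed
    have v\<Omega>: "v \<phi> \<in> desig M \<longleftrightarrow> subst \<sigma> \<phi> \<in> \<Omega>" if "\<phi> \<in> Fm S" for \<phi>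
      using vs[OF that] des[OF subst_in_Fm[OF that \<sigma>]] by simp
    show "\<exists>\<phi>\<in>\<Delta>'. v \<phi> \<in> desig M"
    proof (rule ccontr)
      assume dis: "\<not> (\<exists>\<phi>\<in>\<Delta>'. v \<phi> \<in> desig M)"
      have "subst \<sigma> ` \<Gamma>' \<subseteq> \<Omega>" using v(2) v\<Omega> sub'(1) by auto
      moreover have "subst \<sigma> ` \<Delta>' \<subseteq> Fm S - \<Omega>"
        using dis v\<Omega> sub'(2) subst_in_Fm[OF _ \<sigma>] by auto
      \<comment> \<open>The instance of the rule under \<open>\<sigma>\<close> is in
        \<open>L\<close> and has its premises in \<open>\<Omega>\<close> and its conclusions
        outside, so dilution yields exactly the rule excluded by \<open>n\<Omega>\<close>.\<close>
      ultimately have "(\<Gamma> \<union> \<Omega>, (Fm S - \<Omega>) \<union> \<Delta>) \<in> L"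
        using sub \<Omega> by - (rule mc_logic_dilute[OF L mc_logic_subst[OF L r \<sigma>]], blast+)
      with n\<Omega> show False ..
    qed
  qed
  then have "M \<in> Nmatr S L" using nm unfolding Nmatr_def by auto
  \<comment> \<open>\<open>e\<close> is the valuation that belongs to the identity
    substitution.\<close>
  moreover have "valuation S M e"
    unfolding valuation_def M_def by (auto simp: de map_idI subset_iff)
  then have "(\<Gamma>, \<Delta>) \<notin> logic_of_nmatrix S M"
    using des G D sub unfolding logic_of_nmatrix_iff by blast
  ultimately show thesis by (rule that)
qed

section \<open>Ultrafilters\<close>

text \<open>Zorn's lemma is applied to the families whose finite intersections are all infinite in
  \<open>I\<close>. Asking for infinite rather than nonempty intersections is what forces every
  cofinite set into a maximal family.\<close>

lemma nonprincipal_ultrafilter_exists: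
  assumes "infinite I"
  obtains U where "ultrafilter_on I U" "\<And>X. X \<subseteq> I \<Longrightarrow> finite (I - X) \<Longrightarrow> X \<in> U"
proof -
  define A where "A = {F. F \<subseteq> Pow I \<and> (\<forall>G. finite G \<longrightarrow> G \<subseteq> F \<longrightarrow> infinite (I \<inter> \<Inter>G))}"
  have "\<exists>U\<in>A. \<forall>X\<in>A. U \<subseteq> X \<longrightarrow> X = U"
  proof (rule subset_Zorn_nonempty)
    show "A \<noteq> {}" using assms by (auto simp: A_def intro!: exI[of _ "{}"])
  next
    fix C assume C: "C \<noteq> {}" "subset.chain A C"
    show "\<Union>C \<in> A"
      unfolding A_def
    proof (intro CollectI conjI allI impI)
      show "\<Union>C \<subseteq> Pow I" using C(2) unfolding subset.chain_def A_def by blast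
      fix G assume "finite G" "G \<subseteq> \<Union>C"
      then obtain F where "F \<in> C" "G \<subseteq> F"
        using finite_subset_Union_chain[OF _ _ C] by blast
      then show "infinite (I \<inter> \<Inter>G)"
        using C(2) \<open>finite G\<close> unfolding subset.chain_def A_def by blast
    qed
  qed
  then obtain U where U: "U \<in> A" and max: "\<And>X. X \<in> A \<Longrightarrow> U \<subseteq> X \<Longrightarrow> X = U" by blast
  have UI: "U \<subseteq> Pow I" and fip: "\<And>G. finite G \<Longrightarrow> G \<subseteq> U \<Longrightarrow> infinite (I \<inter> \<Inter>G)"
    using U by (auto simp: A_def)
  \<comment> \<open>Maximality as a membership test: a set belongs to \<open>U\<close> if adjoining
    it preserves infinite intersections.\<close>
  have in_U: "X \<in> U" if "X \<subseteq> I" "\<And>G. finite G \<Longrightarrow> G \<subseteq> U \<Longrightarrow> infinite (I \<inter> \<Inter>G \<inter> X)" for X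
  proof -
    have "insert X U \<in> A"
      unfolding A_def
    proof (intro CollectI conjI allI impI)
      show "insert X U \<subseteq> Pow I" using that UI by blast
      fix G assume G: "finite G" "G \<subseteq> insert X U"
      have "infinite (I \<inter> \<Inter>(G - {X}) \<inter> X)" using that(2)[of "G - {X}"] G by blast
      then show "infinite (I \<inter> \<Inter>G)" by (rule contrapos_nn) (erule rev_finite_subset, blast)
    qed
    then show ?thesis using max by blast
  qed
  \<comment> \<open>A set containing a finite intersection of members up to finitely many points is
    a member. The filter laws and the cofinite sets are instances of this.\<close>
  have upper: "X \<in> U" if "X \<subseteq> I" "finite G" "G \<subseteq> U" "finite (I \<inter> \<Inter>G - X)" for X G
  proof (rule in_U[OF that(1)])
    fix H assume H: "finite H" "H \<subseteq> U"
    have "infinite (I \<inter> \<Inter>(G \<union> H))" using fip that H by blast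
    moreover have "I \<inter> \<Inter>(G \<union> H) \<subseteq> (I \<inter> \<Inter>H \<inter> X) \<union> (I \<inter> \<Inter>G - X)" by blast
    ultimately show "infinite (I \<inter> \<Inter>H \<inter> X)" using that(4) by (meson finite_UnI finite_subset)
  qed
  have "X \<in> U \<or> I - X \<in> U" if X: "X \<subseteq> I" for X
  proof (rule ccontr)
    assume neg: "\<not> (X \<in> U \<or> I - X \<in> U)"
    then obtain G where G: "finite G" "G \<subseteq> U" "finite (I \<inter> \<Inter>G \<inter> X)" using in_U X by blast
    have "I \<inter> \<Inter>G - (I - X) = I \<inter> \<Inter>G \<inter> X" by blast
    then have "I - X \<in> U" using upper[of "I - X" G] G by simp
    with neg show False by blast
  qed
  moreover have "I \<in> U" by (rule upper[of I "{}"]) auto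
  moreover have "{} \<notin> U" using fip[of "{{}}"] by auto
  moreover have "X \<inter> Y \<in> U" if "X \<in> U" "Y \<in> U" for X Y
  proof (rule upper[of _ "{X, Y}"])
    have "I \<inter> \<Inter>{X, Y} - X \<inter> Y = {}" by blast
    then show "finite (I \<inter> \<Inter>{X, Y} - X \<inter> Y)" by (simp only: finite.emptyI)
  qed (use that UI in auto)
  moreover have "Y \<in> U" if "X \<in> U" "X \<subseteq> Y" "Y \<subseteq> I" for X Y
  proof (rule upper[of _ "{X}"])
    have "I \<inter> \<Inter>{X} - Y = {}" using that by blast
    then show "finite (I \<inter> \<Inter>{X} - Y)" by (simp only: finite.emptyI)
  qed (use that in auto)
  ultimately have "ultrafilter_on I U" unfolding ultrafilter_on_def using UI by blast
  moreover have "X \<in> U" if "X \<subseteq> I" "finite (I - X)" for X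
    by (rule upper[of X "{}"]) (use that in auto)
  ultimately show thesis by (rule that)
qed

section \<open>Ultraproducts\<close>

locale ultraproduct_family =
  fixes S :: "nat \<Rightarrow> 'c set" and I :: "'i set" and U and M :: "'i \<Rightarrow> ('c, 'a) nmatrix"
  assumes ultra: "ultrafilter_on I U" and nm: "\<And>i. i \<in> I \<Longrightarrow> nmatrix S (M i)"
begin

text \<open>Reads "for almost all indices", the members of \<open>U\<close> being the large sets.
  The ultrafilter laws become rules for conjunction, negation and finite universal
  quantification.\<close>

definition ae :: "('i \<Rightarrow> bool) \<Rightarrow> bool" where
  "ae P \<longleftrightarrow> {i \<in> I. P i} \<in> U"

lemma ae_mono: "ae P \<Longrightarrow> (\<And>i. i \<in> I \<Longrightarrow> P i \<Longrightarrow> Q i) \<Longrightarrow> ae Q"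
proof -
  assume "ae P" "\<And>i. i \<in> I \<Longrightarrow> P i \<Longrightarrow> Q i"
  then have "{i \<in> I. P i} \<in> U" "{i \<in> I. P i} \<subseteq> {i \<in> I. Q i}" "{i \<in> I. Q i} \<subseteq> I"
    by (auto simp: ae_def)
  then show "ae Q" using ultra unfolding ultrafilter_on_def ae_def by blast
qed

lemma ae_True: "(\<And>i. i \<in> I \<Longrightarrow> P i) \<Longrightarrow> ae P"
proof -
  assume "\<And>i. i \<in> I \<Longrightarrow> P i"
  then have "{i \<in> I. P i} = I" by blast
  then show "ae P" using ultra unfolding ultrafilter_on_def ae_def by simp
qed

lemma ae_conj: "ae P \<Longrightarrow> ae Q \<Longrightarrow> ae (\<lambda>i. P i \<and> Q i)"
proof -
  assume "ae P" "ae Q"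
  then have "{i \<in> I. P i} \<inter> {i \<in> I. Q i} \<in> U"
    using ultra unfolding ultrafilter_on_def ae_def by blast
  moreover have "{i \<in> I. P i} \<inter> {i \<in> I. Q i} = {i \<in> I. P i \<and> Q i}" by blast
  ultimately show ?thesis by (simp add: ae_def)
qed

lemma ae_ball:
  "finite T \<Longrightarrow> (\<And>t. t \<in> T \<Longrightarrow> ae (P t)) \<Longrightarrow> ae (\<lambda>i. \<forall>t\<in>T. P t i)"
proof (induction T rule: finite_induct)
  case empty
  show ?case by (rule ae_True) simp
next
  case (insert t T)
  then have "ae (\<lambda>i. P t i \<and> (\<forall>t\<in>T. P t i))" by (intro ae_conj) auto
  then show ?case by simp
qed

lemma ae_ex: "ae P \<Longrightarrow> \<exists>i\<in>I. P i"
proof (rule ccontr)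
  assume "ae P" "\<not> (\<exists>i\<in>I. P i)"
  then have "{} \<in> U" by (metis (no_types, lifting) ae_def Collect_empty_eq)
  then show False using ultra unfolding ultrafilter_on_def by blast
qed

lemma ae_not: "ae (\<lambda>i. \<not> P i) \<longleftrightarrow> \<not> ae P"
proof
  assume "ae (\<lambda>i. \<not> P i)"
  from ae_ex[OF ae_conj[OF this, of P]] show "\<not> ae P" by blast
next
  assume "\<not> ae P"
  moreover have "\<forall>X. X \<subseteq> I \<longrightarrow> X \<in> U \<or> I - X \<in> U"
    using ultra unfolding ultrafilter_on_def by (elim conjE)
  from this[rule_format, of "{i \<in> I. P i}"] have "ae P \<or> I - {i \<in> I. P i} \<in> U"
    by (simp add: ae_def)
  ultimately have "I - {i \<in> I. P i} \<in> U" by blast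
  moreover have "I - {i \<in> I. P i} = {i \<in> I. \<not> P i}" by blast
  ultimately show "ae (\<lambda>i. \<not> P i)" by (simp add: ae_def)
qed

section \<open>Classes and representatives in the ultraproduct\<close>

abbreviation "prod_truth \<equiv> \<Pi>\<^sub>E i\<in>I. truth (M i)"
abbreviation "cls s \<equiv> ultra_equiv I U M `` {s}"
abbreviation "UP \<equiv> ultraproduct I U M"

lemma ultra_equiv_iff:
  "(s, t) \<in> ultra_equiv I U M \<longleftrightarrow> s \<in> prod_truth \<and> t \<in> prod_truth \<and> ae (\<lambda>i. s i = t i)"
  by (simp add: ultra_equiv_def nm_product_def ae_def)

lemma equiv_ultra_equiv: "equiv prod_truth (ultra_equiv I U M)"
proof (rule equivI)
  show "ultra_equiv I U M \<subseteq> prod_truth \<times> prod_truth" by (auto simp: ultra_equiv_iff)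
  show "refl_on prod_truth (ultra_equiv I U M)"
    by (rule refl_onI) (auto simp: ultra_equiv_iff intro!: ae_True)
  show "sym (ultra_equiv I U M)"
    by (rule symI) (auto simp: ultra_equiv_iff elim: ae_mono)
  show "trans (ultra_equiv I U M)"
  proof (rule transI)
    fix x y z assume "(x, y) \<in> ultra_equiv I U M" "(y, z) \<in> ultra_equiv I U M"
    then show "(x, z) \<in> ultra_equiv I U M"
      using ae_mono[OF ae_conj[of "\<lambda>i. x i = y i" "\<lambda>i. y i = z i"]] by (auto simp: ultra_equiv_iff)
  qed
qed

lemma cls_eq_iff:
  "s \<in> prod_truth \<Longrightarrow> t \<in> prod_truth \<Longrightarrow> cls s = cls t \<longleftrightarrow> ae (\<lambda>i. s i = t i)"
  using eq_equiv_class_iff[OF equiv_ultra_equiv] by (simp add: ultra_equiv_iff)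

lemma truth_UP: "truth UP = prod_truth // ultra_equiv I U M"
  by (simp add: ultraproduct_def nm_quotient_def nm_product_def)

lemma cls_in_truth: "s \<in> prod_truth \<Longrightarrow> cls s \<in> truth UP"
  by (simp add: truth_UP quotientI)

lemma truth_UP_rep: "X \<in> truth UP \<Longrightarrow> \<exists>s\<in>prod_truth. X = cls s"
  by (auto simp: truth_UP elim: quotientE)

lemma desig_UP: "desig UP = cls ` (\<Pi>\<^sub>E i\<in>I. desig (M i))"
  by (auto simp: ultraproduct_def nm_quotient_def nm_product_def)

lemma interp_UP:
  "interp UP c Xs = {cls y | y ys. list_all2 (\<in>) ys Xs \<and>
     y \<in> (\<Pi>\<^sub>E i\<in>I. interp (M i) c (map (\<lambda>s. s i) ys))}"
  by (simp add: ultraproduct_def nm_quotient_def nm_product_def)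

lemma prod_desig_subset: "(\<Pi>\<^sub>E i\<in>I. desig (M i)) \<subseteq> prod_truth"
  using nm by (intro PiE_mono) (auto simp: nmatrix_def)

lemma interp_props:
  assumes "i \<in> I" "c \<in> S (length ss)" "set ss \<subseteq> prod_truth"
  shows "interp (M i) c (map (\<lambda>s. s i) ss) \<subseteq> truth (M i)"
    and "interp (M i) c (map (\<lambda>s. s i) ss) \<noteq> {}"
proof -
  have "set (map (\<lambda>s. s i) ss) \<subseteq> truth (M i)" using assms by (auto simp: PiE_iff)
  then show "interp (M i) c (map (\<lambda>s. s i) ss) \<subseteq> truth (M i)"
    and "interp (M i) c (map (\<lambda>s. s i) ss) \<noteq> {}"
    using nm[OF assms(1)] assms(2) unfolding nmatrix_def by (metis length_map)+
qed

lemma cls_in_desigD: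
  assumes s: "s \<in> prod_truth" and d: "cls s \<in> desig UP"
  shows "ae (\<lambda>i. s i \<in> desig (M i))"
proof -
  obtain t where t: "t \<in> (\<Pi>\<^sub>E i\<in>I. desig (M i))" "cls s = cls t" using d by (auto simp: desig_UP)
  then have "ae (\<lambda>i. s i = t i)" using s prod_desig_subset cls_eq_iff by blast
  then show ?thesis by (rule ae_mono) (use t in auto)
qed

text \<open>Nonemptiness is needed: one empty \<open>desig (M i)\<close>, even on a null set of indices,
  makes the product, and hence \<open>desig UP\<close>, empty.\<close>

lemma cls_in_desigI:
  assumes s: "s \<in> prod_truth" and ne: "\<forall>i\<in>I. desig (M i) \<noteq> {}"
    and a: "ae (\<lambda>i. s i \<in> desig (M i))"
  shows "cls s \<in> desig UP"
proof -
  \<comment> \<open>\<open>t\<close> corrects \<open>s\<close> on a null set so that it is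
    designated in every coordinate, as \<open>desig UP\<close> demands of some
    representative.\<close>
  define t where "t = (\<lambda>i\<in>I. if s i \<in> desig (M i) then s i else (SOME x. x \<in> desig (M i)))"
  have t: "t \<in> (\<Pi>\<^sub>E i\<in>I. desig (M i))" using ne by (auto simp: t_def some_in_eq)
  have "ae (\<lambda>i. s i = t i)" using a by (rule ae_mono) (simp add: t_def)
  then have "cls s = cls t" using s t prod_desig_subset cls_eq_iff by blast
  then show ?thesis using t by (auto simp: desig_UP)
qed

text \<open>The case of Los's theorem for the interpretation of a connective. Left to right, the
  representatives \<open>y\<close> and \<open>ys\<close> differ from \<open>s\<close> and
  \<open>ss\<close> on a null set, there being finitely many arguments. Right to left,
  \<open>s\<close> is corrected on a null set; admissible values exist at every index because the
  factors are Nmatrices.\<close>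

lemma cls_in_interp_iff:
  assumes c: "c \<in> S (length ss)" and ss: "set ss \<subseteq> prod_truth" and s: "s \<in> prod_truth"
  shows "cls s \<in> interp UP c (map (\<lambda>s. cls s) ss) \<longleftrightarrow>
    ae (\<lambda>i. s i \<in> interp (M i) c (map (\<lambda>s. s i) ss))"
proof
  assume "cls s \<in> interp UP c (map (\<lambda>s. cls s) ss)"
  then obtain y ys where y: "cls s = cls y" "y \<in> (\<Pi>\<^sub>E i\<in>I. interp (M i) c (map (\<lambda>s. s i) ys))"
    and ys: "list_all2 (\<in>) ys (map (\<lambda>s. cls s) ss)" by (auto simp: interp_UP)
  have len: "length ys = length ss" using ys by (auto dest: list_all2_lengthD)
  have "s \<in> cls y" using y(1) equiv_class_self[OF equiv_ultra_equiv s] by simp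
  then have 1: "ae (\<lambda>i. y i = s i)" by (simp add: ultra_equiv_iff)
  have "ae (\<lambda>i. \<forall>j\<in>{..<length ss}. (ys ! j) i = (ss ! j) i)"
  proof (rule ae_ball)
    fix j assume j: "j \<in> {..<length ss}"
    then have "ys ! j \<in> cls (ss ! j)" using ys by (auto simp: list_all2_conv_all_nth)
    then have "ae (\<lambda>i. (ss ! j) i = (ys ! j) i)" by (simp add: ultra_equiv_iff)
    then show "ae (\<lambda>i. (ys ! j) i = (ss ! j) i)" by (rule ae_mono) simp
  qed simp
  from ae_conj[OF 1 this] show "ae (\<lambda>i. s i \<in> interp (M i) c (map (\<lambda>s. s i) ss))"
  proof (rule ae_mono)
    fix i assume i: "i \<in> I" "y i = s i \<and> (\<forall>j\<in>{..<length ss}. (ys ! j) i = (ss ! j) i)"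
    then have "map (\<lambda>s. s i) ys = map (\<lambda>s. s i) ss" by (intro nth_equalityI) (auto simp: len)
    then show "s i \<in> interp (M i) c (map (\<lambda>s. s i) ss)"
      using i PiE_mem[OF y(2) i(1)] by simp
  qed
next
  let ?N = "\<lambda>i. interp (M i) c (map (\<lambda>s. s i) ss)"
  assume a: "ae (\<lambda>i. s i \<in> ?N i)"
  define t where "t = (\<lambda>i\<in>I. if s i \<in> ?N i then s i else (SOME x. x \<in> ?N i))"
  have t: "t \<in> (\<Pi>\<^sub>E i\<in>I. ?N i)"
    using interp_props(2)[OF _ c ss] by (auto simp: t_def some_in_eq)
  then have t': "t \<in> prod_truth" using interp_props(1)[OF _ c ss] by (auto simp: PiE_iff)
  have "ae (\<lambda>i. s i = t i)" using a by (rule ae_mono) (simp add: t_def)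
  then have "cls s = cls t" using s t' cls_eq_iff by blast
  moreover have "list_all2 (\<in>) ss (map (\<lambda>s. cls s) ss)"
    using ss equiv_class_self[OF equiv_ultra_equiv]
    by (simp add: list_all2_conv_all_nth subset_iff)
  ultimately show "cls s \<in> interp UP c (map (\<lambda>s. cls s) ss)" using t by (auto simp: interp_UP)
qed

lemma truth_UP_reps:
  assumes "set Xs \<subseteq> truth UP"
  obtains ss where "set ss \<subseteq> prod_truth" "Xs = map (\<lambda>s. cls s) ss"
proof -
  have "\<exists>s. s \<in> prod_truth \<and> X = cls s" if "X \<in> set Xs" for X
    using truth_UP_rep[of X] that assms by auto
  then obtain r where r: "\<And>X. X \<in> set Xs \<Longrightarrow> r X \<in> prod_truth"
    "\<And>X. X \<in> set Xs \<Longrightarrow> X = cls (r X)"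
    by metis
  show thesis
  proof (rule that)
    show "set (map r Xs) \<subseteq> prod_truth" using r(1) by auto
    show "Xs = map (\<lambda>s. cls s) (map r Xs)"
      unfolding map_map comp_def by (rule sym, rule map_idI, rule sym, rule r(2))
  qed
qed

lemma nmatrix_UP: "nmatrix S UP"
  unfolding nmatrix_def
proof (intro conjI allI impI)
  show "desig UP \<subseteq> truth UP"
    unfolding desig_UP using prod_desig_subset cls_in_truth by blast
  fix c Xs assume c: "c \<in> S (length Xs)" and Xs: "set Xs \<subseteq> truth UP"
  show "interp UP c Xs \<subseteq> truth UP"
  proof
    fix Y assume "Y \<in> interp UP c Xs"
    then obtain y ys where Y: "Y = cls y" and ys: "list_all2 (\<in>) ys Xs"
      and y: "y \<in> (\<Pi>\<^sub>E i\<in>I. interp (M i) c (map (\<lambda>s. s i) ys))" by (auto simp: interp_UP)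
    have "X \<subseteq> prod_truth" if "X \<in> truth UP" for X
      using truth_UP_rep[OF that] by (auto simp: ultra_equiv_iff)
    then have "z \<in> prod_truth" if "z \<in> set ys" for z
      using that Xs ys unfolding list_all2_conv_all_nth in_set_conv_nth
      by (metis nth_mem subsetD)
    then have "set ys \<subseteq> prod_truth" by blast
    moreover have "c \<in> S (length ys)" using c ys by (auto dest: list_all2_lengthD)
    ultimately have "y \<in> prod_truth" using y interp_props(1)[of _ c ys] by (auto simp: PiE_iff)
    then show "Y \<in> truth UP" using Y cls_in_truth by blast
  qed
  obtain ss where ss: "set ss \<subseteq> prod_truth" "Xs = map (\<lambda>s. cls s) ss"
    using truth_UP_reps[OF Xs] by blast
  then have c': "c \<in> S (length ss)" using c by simp
  define y where "y = (\<lambda>i\<in>I. SOME x. x \<in> interp (M i) c (map (\<lambda>s. s i) ss))"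
  have y: "y i \<in> interp (M i) c (map (\<lambda>s. s i) ss)" if "i \<in> I" for i
    using interp_props(2)[OF that c' ss(1)] that by (simp add: y_def some_in_eq)
  then have "y \<in> prod_truth"
    using interp_props(1)[OF _ c' ss(1)] by (auto simp: PiE_iff y_def)
  then have "cls y \<in> interp UP c Xs"
    using cls_in_interp_iff[OF c' ss(1)] ae_True[of "\<lambda>i. y i \<in> interp (M i) c (map (\<lambda>s. s i) ss)"] y
    by (simp add: ss(2))
  then show "interp UP c Xs \<noteq> {}" by blast
qed

section \<open>Transfer of rules between factors and ultraproduct\<close>

text \<open>The valuations \<open>v i\<close> combine coordinatewise into one of \<open>UP\<close>.
  Each formula of the rule comes with its own large set of indices, so \<open>\<Gamma>\<close> and
  \<open>\<Delta>\<close> may be infinite. The condition \<open>ne\<close> serves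
  \<open>cls_in_desigI\<close>.\<close>

lemma refuted_in_UP:
  fixes v :: "'i \<Rightarrow> ('c, 'p) fm \<Rightarrow> 'a"
  assumes v: "\<And>i. i \<in> I \<Longrightarrow> valuation S (M i) (v i)"
    and sub: "\<Gamma> \<subseteq> Fm S" "\<Delta> \<subseteq> Fm S"
    and \<Gamma>: "\<And>\<phi>. \<phi> \<in> \<Gamma> \<Longrightarrow> ae (\<lambda>i. v i \<phi> \<in> desig (M i))"
    and \<Delta>: "\<And>\<phi>. \<phi> \<in> \<Delta> \<Longrightarrow> ae (\<lambda>i. v i \<phi> \<notin> desig (M i))"
    and ne: "\<Gamma> = {} \<or> (\<forall>i\<in>I. desig (M i) \<noteq> {})"
  shows "(\<Gamma>, \<Delta>) \<notin> logic_of_nmatrix S UP"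
proof -
  define s where "s \<phi> = (\<lambda>i\<in>I. v i \<phi>)" for \<phi>
  have s: "s \<phi> \<in> prod_truth" if "\<phi> \<in> Fm S" for \<phi>
    using v that by (auto simp: s_def valuation_def)
  have sI: "s \<phi> i = v i \<phi>" if "i \<in> I" for \<phi> i using that by (simp add: s_def)
  define w where "w \<phi> = cls (s \<phi>)" for \<phi>
  have "valuation S UP w"
    unfolding valuation_def
  proof (intro conjI allI impI)
    show "w \<in> Fm S \<rightarrow> truth UP" using s cls_in_truth by (auto simp: w_def)
    fix c and \<phi>s :: "('c, 'p) fm list"
    assume c: "c \<in> S (length \<phi>s)" and \<phi>s: "set \<phi>s \<subseteq> Fm S"
    have A: "App c \<phi>s \<in> Fm S" using c \<phi>s by (auto intro: Fm.App)
    have "ae (\<lambda>i. s (App c \<phi>s) i \<in> interp (M i) c (map (\<lambda>s. s i) (map s \<phi>s)))"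
    proof (rule ae_True)
      fix i assume i: "i \<in> I"
      have "map (\<lambda>s. s i) (map s \<phi>s) = map (v i) \<phi>s" using i by (simp add: sI)
      then show "s (App c \<phi>s) i \<in> interp (M i) c (map (\<lambda>s. s i) (map s \<phi>s))"
        using v[OF i] c \<phi>s i unfolding valuation_def by (simp add: sI del: map_map)
    qed
    moreover have "map w \<phi>s = map (\<lambda>s. cls s) (map s \<phi>s)" by (simp add: w_def)
    moreover have "set (map s \<phi>s) \<subseteq> prod_truth" using \<phi>s s by auto
    ultimately show "w (App c \<phi>s) \<in> interp UP c (map w \<phi>s)"
      using cls_in_interp_iff[of c "map s \<phi>s" "s (App c \<phi>s)"] c s[OF A]
      by (simp only: w_def length_map)
  qed
  moreover have "w \<phi> \<in> desig UP" if "\<phi> \<in> \<Gamma>" for \<phi>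
    unfolding w_def using that ne sub s
    by (intro cls_in_desigI ae_mono[OF \<Gamma>[OF that]]) (auto simp: sI)
  moreover have "w \<phi> \<notin> desig UP" if "\<phi> \<in> \<Delta>" for \<phi>
  proof
    assume "w \<phi> \<in> desig UP"
    then have "ae (\<lambda>i. s \<phi> i \<in> desig (M i))"
      unfolding w_def using that sub s by (intro cls_in_desigD) auto
    from ae_ex[OF ae_conj[OF this \<Delta>[OF that]]] show False by (auto simp: sI)
  qed
  ultimately show ?thesis using logic_of_nmatrixD[of \<Gamma> \<Delta> S UP w] by blast
qed

lemma truth_nonempty_of_UP: "truth UP \<noteq> {} \<Longrightarrow> i \<in> I \<Longrightarrow> truth (M i) \<noteq> {}"
  using truth_UP_rep by (fastforce simp: PiE_iff)

text \<open>A refuting valuation of the ultraproduct only matters on the finitely many subformulas of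
  the rule; there it is induced by partial valuations of almost all factors, which extend.\<close>

lemma finite_rule_valid_in_UP:
  fixes \<Gamma> \<Delta> :: "('c, 'p) fm set"
  assumes fin: "finite \<Gamma>" "finite \<Delta>"
    and valid: "ae (\<lambda>i. (\<Gamma>, \<Delta>) \<in> logic_of_nmatrix S (M i))"
    and ne: "\<Gamma> \<noteq> {} \<or> (\<forall>i\<in>I. desig (M i) \<noteq> {})"
  shows "(\<Gamma>, \<Delta>) \<in> logic_of_nmatrix S UP"
proof (rule ccontr)
  assume neg: "(\<Gamma>, \<Delta>) \<notin> logic_of_nmatrix S UP"
  have sub: "\<Gamma> \<subseteq> Fm S" "\<Delta> \<subseteq> Fm S" using ae_ex[OF valid] by (auto simp: logic_of_nmatrix_iff)
  then obtain v where v: "valuation S UP v" "\<forall>\<phi>\<in>\<Gamma>. v \<phi> \<in> desig UP" "\<forall>\<phi>\<in>\<Delta>. v \<phi> \<notin> desig UP"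
    using not_in_logic_of_nmatrixE[OF neg] by blast
  \<comment> \<open>If there is a premise, its class is designated in \<open>UP\<close>, hence has a
    representative that is designated in every factor.\<close>
  have D: "desig (M i) \<noteq> {}" if i: "i \<in> I" for i
    using ne
  proof
    assume "\<Gamma> \<noteq> {}"
    then have "desig UP \<noteq> {}" using v(2) by blast
    then show ?thesis using i by (auto simp: desig_UP)
  qed (use i in blast)
  have vt: "v \<phi> \<in> truth UP" if "\<phi> \<in> Fm S" for \<phi> using v(1) that by (auto simp: valuation_def)
  have truth_ne: "truth (M i) \<noteq> {}" if "i \<in> I" for i
    using truth_nonempty_of_UP[OF _ that] vt[OF Fm.Var] by blast
  have "\<exists>s. \<forall>\<phi>\<in>Fm S. s \<phi> \<in> prod_truth \<and> v \<phi> = cls (s \<phi>)"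
    by (rule bchoice) (use vt truth_UP_rep in blast)
  then obtain s where s: "\<And>\<phi>. \<phi> \<in> Fm S \<Longrightarrow> s \<phi> \<in> prod_truth" "\<And>\<phi>. \<phi> \<in> Fm S \<Longrightarrow> v \<phi> = cls (s \<phi>)"
    by blast
  define T where "T = \<Union> (subfm ` (\<Gamma> \<union> \<Delta>))"
  have TF: "T \<subseteq> Fm S" unfolding T_def using sub subfm_subset_Fm by blast
  have finT: "finite T" unfolding T_def using fin finite_subfm by blast
  have closed: "set \<phi>s \<subseteq> T" if "App c \<phi>s \<in> T" for c \<phi>s
  proof -
    obtain \<phi> where "\<phi> \<in> \<Gamma> \<union> \<Delta>" "App c \<phi>s \<in> subfm \<phi>" using \<open>App c \<phi>s \<in> T\<close> by (auto simp: T_def)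
    with subfm_App_closed[OF this(2)] show ?thesis by (auto simp: T_def)
  qed
  have GT: "\<Gamma> \<subseteq> T" "\<Delta> \<subseteq> T" unfolding T_def using subfm_refl by blast+
  \<comment> \<open>The valuation condition at one formula; variables satisfy it vacuously.\<close>
  let ?P = "\<lambda>\<phi> i. \<forall>c \<phi>s. \<phi> = App c \<phi>s \<longrightarrow> s \<phi> i \<in> interp (M i) c (map (\<lambda>\<psi>. s \<psi> i) \<phi>s)"
  have 1: "ae (\<lambda>i. \<forall>\<phi>\<in>T. ?P \<phi> i)"
  proof (rule ae_ball[OF finT])
    fix \<phi> assume \<phi>: "\<phi> \<in> T"
    show "ae (?P \<phi>)"
    proof (cases \<phi>)
      case (Var p)
      then show ?thesis by (intro ae_True) simp
    next
      case (App c \<phi>s)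
      then have AF: "App c \<phi>s \<in> Fm S" using \<phi> TF by blast
      from Fm_AppD[OF this] have c: "c \<in> S (length \<phi>s)" and \<phi>s: "set \<phi>s \<subseteq> Fm S" by auto
      have "map v \<phi>s = map (\<lambda>s. cls s) (map s \<phi>s)" using \<phi>s s(2) by auto
      moreover have set_s: "set (map s \<phi>s) \<subseteq> prod_truth" using \<phi>s s(1) by auto
      moreover have "v (App c \<phi>s) \<in> interp UP c (map v \<phi>s)"
        using v(1) c \<phi>s unfolding valuation_def by blast
      ultimately have "ae (\<lambda>i. s (App c \<phi>s) i \<in> interp (M i) c (map (\<lambda>s. s i) (map s \<phi>s)))"
        using cls_in_interp_iff[of c "map s \<phi>s" "s (App c \<phi>s)"] c set_s s[OF AF]
        by (simp only: length_map)
      then show ?thesis by (rule ae_mono) (simp add: App comp_def)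
    qed
  qed
  have 2: "ae (\<lambda>i. \<forall>\<phi>\<in>\<Gamma>. s \<phi> i \<in> desig (M i))"
  proof (rule ae_ball[OF fin(1)], rule cls_in_desigD)
    fix \<phi> assume \<phi>: "\<phi> \<in> \<Gamma>"
    then have "\<phi> \<in> Fm S" using sub(1) by blast
    with s v(2) \<phi> show "s \<phi> \<in> prod_truth" "cls (s \<phi>) \<in> desig UP" by auto
  qed
  have 3: "ae (\<lambda>i. \<forall>\<phi>\<in>\<Delta>. s \<phi> i \<notin> desig (M i))"
  proof (rule ae_ball[OF fin(2)])
    fix \<phi> assume \<phi>: "\<phi> \<in> \<Delta>"
    then have "\<phi> \<in> Fm S" using sub(2) by blast
    with s v(3) \<phi> have "s \<phi> \<in> prod_truth" "cls (s \<phi>) \<notin> desig UP" by auto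
    then show "ae (\<lambda>i. s \<phi> i \<notin> desig (M i))"
      unfolding ae_not using cls_in_desigI[of "s \<phi>"] D by auto
  qed
  \<comment> \<open>Finitely many almost-everywhere conditions hold together at some index
    \<open>i\<close>. There the partial valuation on \<open>T\<close> extends to one refuting a rule
    that \<open>M i\<close> validates.\<close>
  obtain i where i: "i \<in> I" and val: "(\<Gamma>, \<Delta>) \<in> logic_of_nmatrix S (M i)"
    and i1: "\<forall>\<phi>\<in>T. ?P \<phi> i"
    and i2: "\<forall>\<phi>\<in>\<Gamma>. s \<phi> i \<in> desig (M i)" and i3: "\<forall>\<phi>\<in>\<Delta>. s \<phi> i \<notin> desig (M i)"
    using ae_ex[OF ae_conj[OF valid ae_conj[OF 1 ae_conj[OF 2 3]]]] by blast
  let ?e = "extend_val (M i) T (\<lambda>\<phi>. s \<phi> i)"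
  have "valuation S (M i) ?e"
  proof (rule valuation_extend_val[OF nm[OF i] truth_ne[OF i]])
    show "s \<phi> i \<in> truth (M i)" if "\<phi> \<in> T" for \<phi>
      using s(1) that TF i by (metis PiE_mem subsetD)
    show "s (App c \<phi>s) i \<in> interp (M i) c (map (\<lambda>\<phi>. s \<phi> i) \<phi>s)" if "App c \<phi>s \<in> T" for c \<phi>s
      using i1 that by blast
  qed (rule closed)
  moreover have "\<forall>\<phi>\<in>\<Gamma>. ?e \<phi> \<in> desig (M i)" using i2 GT by (auto simp: extend_val_eq subset_iff)
  moreover have "\<forall>\<phi>\<in>\<Delta>. ?e \<phi> \<notin> desig (M i)" using i3 GT by (auto simp: extend_val_eq subset_iff)
  ultimately show False using logic_of_nmatrixD[OF val, of ?e] by blast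
qed

end

section \<open>Finite bases\<close>

text \<open>Transports a nonprincipal ultrafilter on the natural numbers to the index type:
  \<open>J\<close> is a copy of \<open>nat\<close>, \<open>ix\<close> numbers its elements, and all
  tails are large.\<close>

lemma sequence_ultrafilter_exists:
  assumes "infinite (UNIV :: 'i set)"
  obtains J :: "'i set" and U and ix :: "'i \<Rightarrow> nat"
  where "ultrafilter_on J U" "\<And>k. {i \<in> J. k \<le> ix i} \<in> U"
proof -
  obtain e :: "nat \<Rightarrow> 'i" where e: "inj e" using infinite_countable_subset[OF assms] by blast
  then have "infinite (range e)" by (rule range_inj_infinite)
  then obtain U where U: "ultrafilter_on (range e) U"
    and cof: "\<And>X. X \<subseteq> range e \<Longrightarrow> finite (range e - X) \<Longrightarrow> X \<in> U"
    using nonprincipal_ultrafilter_exists by blast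
  have "{i \<in> range e. k \<le> inv e i} \<in> U" for k
  proof (rule cof)
    have "range e - {i \<in> range e. k \<le> inv e i} \<subseteq> e ` {..<k}" using e by auto
    then show "finite (range e - {i \<in> range e. k \<le> inv e i})" using finite_surj by blast
  qed blast
  with U show thesis by (rule that)
qed

section \<open>From a finite base to closure of both classes\<close>

text \<open>Rests on the finiteness of the single rules, through
  \<open>finite_rule_valid_in_UP\<close>.\<close>

lemma Nmatr_closed_if_finitely_based:
  fixes S :: "nat \<Rightarrow> 'c set" and L R :: "('c, 'p) mc_rule set"
  assumes R: "L = logic_of_rules S R" "\<forall>r\<in>R. finite_rule r"
  shows "closed_under_ultraproducts
    (Nmatr S L :: ('c, 'a) nmatrix set) (Nmatr S L :: ('c, ('i \<Rightarrow> 'a) set) nmatrix set)"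
  unfolding closed_under_ultraproducts_def
proof (intro allI impI)
  fix I :: "'i set" and U and M :: "'i \<Rightarrow> ('c, 'a) nmatrix"
  assume U: "ultrafilter_on I U" and M: "\<forall>i\<in>I. M i \<in> Nmatr S L"
  interpret ultraproduct_family S I U M
    by unfold_locales (use U M in \<open>auto simp: Nmatr_def\<close>)
  have "(\<Gamma>, \<Delta>) \<in> logic_of_nmatrix S UP" if r: "(\<Gamma>, \<Delta>) \<in> R" for \<Gamma> \<Delta>
  \<comment> \<open>The case outside \<open>finite_rule_valid_in_UP\<close>: no premises, and a
    factor designating nothing. That factor validates the rule only by having no valuation, so its
    set of truth values is empty. Then \<open>truth UP\<close> is empty as well, and
    \<open>UP\<close> validates the rule vacuously.\<close>
  proof (cases "\<Gamma> = {} \<and> (\<exists>i\<in>I. desig (M i) = {})")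
    case True
    then obtain i where i: "i \<in> I" "desig (M i) = {}" by blast
    have val: "(\<Gamma>, \<Delta>) \<in> logic_of_nmatrix S (M i)" using M i r R(1) Nmatr_logic_of_rules by blast
    have "truth (M i) = {}"
    proof (rule ccontr)
      assume "truth (M i) \<noteq> {}"
      then obtain v :: "('c, 'p) fm \<Rightarrow> 'a" where "valuation S (M i) v"
        using valuation_exists[OF nm[OF i(1)]] by blast
      from logic_of_nmatrixD[OF val this] show False using True i by simp
    qed
    then have "truth UP = {}" using truth_nonempty_of_UP i by blast
    then have "\<not> valuation S UP v" for v :: "('c, 'p) fm \<Rightarrow> _"
      using Fm.Var by (fastforce simp: valuation_def)
    then show ?thesis using val by (simp add: logic_of_nmatrix_iff)
  next
    case False
    show ?thesis
    proof (rule finite_rule_valid_in_UP)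
      show "finite \<Gamma>" "finite \<Delta>" using R(2) r by (auto simp: finite_rule_def)
      show "ae (\<lambda>i. (\<Gamma>, \<Delta>) \<in> logic_of_nmatrix S (M i))"
        by (rule ae_True) (use M r R(1) Nmatr_logic_of_rules in blast)
    qed (use False in blast)
  qed
  then show "UP \<in> Nmatr S L" unfolding R(1) Nmatr_logic_of_rules using nmatrix_UP by auto
qed

text \<open>Rests on the finiteness of \<open>R\<close>: every factor refutes some rule of
  \<open>R\<close>, so a single rule is refuted in almost all factors.\<close>

lemma co_Nmatr_closed_if_finitely_based:
  fixes S :: "nat \<Rightarrow> 'c set" and L R :: "('c, 'p) mc_rule set"
  assumes R: "L = logic_of_rules S R" "R \<subseteq> Pow (Fm S) \<times> Pow (Fm S)" "finite R"
  shows "closed_under_ultraproducts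
    (co_Nmatr S L :: ('c, 'a) nmatrix set) (co_Nmatr S L :: ('c, ('i \<Rightarrow> 'a) set) nmatrix set)"
  unfolding closed_under_ultraproducts_def
proof (intro allI impI)
  fix I :: "'i set" and U and M :: "'i \<Rightarrow> ('c, 'a) nmatrix"
  assume U: "ultrafilter_on I U" and M: "\<forall>i\<in>I. M i \<in> co_Nmatr S L"
  interpret ultraproduct_family S I U M
    by unfold_locales (use U M in \<open>auto simp: co_Nmatr_def\<close>)
  have bad: "\<exists>r\<in>R. r \<notin> logic_of_nmatrix S (M i)" if "i \<in> I" for i
    using M that nm Nmatr_logic_of_rules[of "M i" S R] unfolding co_Nmatr_def R(1) by blast
  have R_Fm: "fst r \<subseteq> Fm S" "snd r \<subseteq> Fm S" if "r \<in> R" for r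
    using subsetD[OF R(2) that] by (simp_all add: mem_Times_iff)
  \<comment> \<open>A valuation is provided also where \<open>r\<close> is valid, because
    \<open>refuted_in_UP\<close> combines valuations of all factors.\<close>
  have val: "\<exists>v. valuation S (M i) v \<and> (r \<notin> logic_of_nmatrix S (M i) \<longrightarrow>
      (\<forall>\<phi>\<in>fst r. v \<phi> \<in> desig (M i)) \<and> (\<forall>\<phi>\<in>snd r. v \<phi> \<notin> desig (M i)))" if i: "i \<in> I" and "r \<in> R" for i r
  proof -
    obtain \<Gamma>' \<Delta>' where r': "(\<Gamma>', \<Delta>') \<in> R" "(\<Gamma>', \<Delta>') \<notin> logic_of_nmatrix S (M i)"
      using bad[OF i] by auto
    then have "\<Gamma>' \<subseteq> Fm S" "\<Delta>' \<subseteq> Fm S" using R(2) by auto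
    with r'(2) obtain v' :: "('c, 'p) fm \<Rightarrow> 'a" where v': "valuation S (M i) v'"
      by (rule not_in_logic_of_nmatrixE)
    show ?thesis
    proof (cases "r \<in> logic_of_nmatrix S (M i)")
      case True
      with v' show ?thesis by blast
    next
      case False
      then have "(fst r, snd r) \<notin> logic_of_nmatrix S (M i)" by simp
      from not_in_logic_of_nmatrixE[OF this R_Fm[OF \<open>r \<in> R\<close>]] show ?thesis by metis
    qed
  qed
  have "\<exists>r\<in>R. r \<notin> logic_of_nmatrix S UP"
  \<comment> \<open>A factor designating nothing empties \<open>desig UP\<close>. The rule it
    refutes has no premises, so every valuation of \<open>UP\<close> refutes that rule.\<close>
  proof (cases "\<exists>i\<in>I. desig (M i) = {}")
    case True
    then obtain i where i: "i \<in> I" "desig (M i) = {}" by blast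
    obtain r where r: "r \<in> R" "r \<notin> logic_of_nmatrix S (M i)" using bad[OF i(1)] by blast
    obtain \<Gamma> \<Delta> where rGD: "r = (\<Gamma>, \<Delta>)" by force
    have "\<Gamma> = {}" using val[OF i(1) r(1)] r(2) i(2) rGD by auto
    have "\<exists>v. \<forall>i\<in>I. valuation S (M i) (v i :: ('c, 'p) fm \<Rightarrow> 'a)"
      by (rule bchoice) (use val r in blast)
    then obtain v :: "'i \<Rightarrow> ('c, 'p) fm \<Rightarrow> 'a" where v: "\<And>i. i \<in> I \<Longrightarrow> valuation S (M i) (v i)" by blast
    \<comment> \<open>Refuting the empty rule amounts to having a valuation.\<close>
    obtain w :: "('c, 'p) fm \<Rightarrow> _" where "valuation S UP w"
      using not_in_logic_of_nmatrixE[OF refuted_in_UP[OF v, of "{}" "{}"]] by auto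
    moreover have "desig UP = {}" unfolding desig_UP using i by (auto simp: PiE_eq_empty_iff)
    ultimately have "r \<notin> logic_of_nmatrix S UP"
      unfolding rGD \<open>\<Gamma> = {}\<close> using logic_of_nmatrixD[of "{}" \<Delta> S UP w] by auto
    then show ?thesis using r by blast
  next
    case False
    \<comment> \<open>Otherwise each of the finitely many rules would hold almost everywhere, hence
      all of them at one index, against \<open>bad\<close>.\<close>
    have "\<exists>r\<in>R. ae (\<lambda>i. r \<notin> logic_of_nmatrix S (M i))"
    proof (rule ccontr)
      assume "\<not> ?thesis"
      then have "ae (\<lambda>i. \<forall>r\<in>R. r \<in> logic_of_nmatrix S (M i))"
        using ae_not by (intro ae_ball[OF R(3)]) blast
      from ae_ex[OF this] show False using bad by blast
    qed
    then obtain r where r: "r \<in> R" "ae (\<lambda>i. r \<notin> logic_of_nmatrix S (M i))" by blast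
    have "\<exists>v. \<forall>i\<in>I. valuation S (M i) (v i :: ('c, 'p) fm \<Rightarrow> 'a) \<and>
        (r \<notin> logic_of_nmatrix S (M i) \<longrightarrow>
          (\<forall>\<phi>\<in>fst r. v i \<phi> \<in> desig (M i)) \<and> (\<forall>\<phi>\<in>snd r. v i \<phi> \<notin> desig (M i)))"
      by (rule bchoice) (use val r in blast)
    then obtain v :: "'i \<Rightarrow> ('c, 'p) fm \<Rightarrow> 'a"
      where v: "\<And>i. i \<in> I \<Longrightarrow> valuation S (M i) (v i)"
        and v': "\<And>i. i \<in> I \<Longrightarrow> r \<notin> logic_of_nmatrix S (M i) \<Longrightarrow>
          (\<forall>\<phi>\<in>fst r. v i \<phi> \<in> desig (M i)) \<and> (\<forall>\<phi>\<in>snd r. v i \<phi> \<notin> desig (M i))"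
      by blast
    have "(fst r, snd r) \<notin> logic_of_nmatrix S UP"
    proof (rule refuted_in_UP[OF v])
      show "fst r \<subseteq> Fm S" "snd r \<subseteq> Fm S" using R_Fm[OF r(1)] .
      show "ae (\<lambda>i. v i \<phi> \<in> desig (M i))" if "\<phi> \<in> fst r" for \<phi>
        by (rule ae_mono[OF r(2)]) (use v' that in blast)
      show "ae (\<lambda>i. v i \<phi> \<notin> desig (M i))" if "\<phi> \<in> snd r" for \<phi>
        by (rule ae_mono[OF r(2)]) (use v' that in blast)
    qed (use False in auto)
    then show ?thesis using r by auto
  qed
  then show "UP \<in> co_Nmatr S L"
    unfolding co_Nmatr_def R(1) using nmatrix_UP Nmatr_logic_of_rules[of UP S R] by blast
qed

section \<open>From closure of both classes to a finite base\<close>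

lemma closed_under_ultraproductsD:
  assumes "closed_under_ultraproducts K K'" "ultrafilter_on I U" "\<And>i. i \<in> I \<Longrightarrow> M i \<in> K"
  shows "ultraproduct I U M \<in> K'"
  using assms unfolding closed_under_ultraproducts_def by simp

lemma finitary_if_Nmatr_closed:
  fixes S :: "nat \<Rightarrow> 'c set" and L :: "('c, 'p) mc_rule set"
  assumes count: "countable (Fm S :: ('c, 'p) fm set)"
    and inf: "infinite (UNIV :: 'a set)" "infinite (UNIV :: 'i set)"
    and L: "mc_logic S L"
    and closed: "closed_under_ultraproducts
      (Nmatr S L :: ('c, 'a) nmatrix set) (Nmatr S L :: ('c, ('i \<Rightarrow> 'a) set) nmatrix set)"
    and r: "(\<Gamma>, \<Delta>) \<in> L"
  obtains \<Gamma>' \<Delta>' where "finite \<Gamma>'" "finite \<Delta>'" "\<Gamma>' \<subseteq> \<Gamma>" "\<Delta>' \<subseteq> \<Delta>" "(\<Gamma>', \<Delta>') \<in> L"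
proof (rule ccontr)
  assume "\<not> thesis"
  then have no: "(\<Gamma>', \<Delta>') \<notin> L" if "finite \<Gamma>'" "finite \<Delta>'" "\<Gamma>' \<subseteq> \<Gamma>" "\<Delta>' \<subseteq> \<Delta>" for \<Gamma>' \<Delta>'
    using \<open>\<And>\<Gamma>' \<Delta>'. \<lbrakk>finite \<Gamma>'; finite \<Delta>'; \<Gamma>' \<subseteq> \<Gamma>; \<Delta>' \<subseteq> \<Delta>; (\<Gamma>', \<Delta>') \<in> L\<rbrakk> \<Longrightarrow> thesis\<close> that by blast
  have sub: "\<Gamma> \<subseteq> Fm S" "\<Delta> \<subseteq> Fm S" using r mc_logic_subset[OF L] by auto
  obtain J :: "'i set" and U and ix :: "'i \<Rightarrow> nat"
    where U: "ultrafilter_on J U" and large: "\<And>k. {i \<in> J. k \<le> ix i} \<in> U"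
    using sequence_ultrafilter_exists[OF inf(2)] by blast
  define code where "code = to_nat_on (Fm S :: ('c, 'p) fm set)"
  have code: "inj_on code (Fm S)" unfolding code_def using count by (rule inj_on_to_nat_on)
  \<comment> \<open>Finite stages exhausting \<open>\<Psi>\<close>: a formula belongs to all stages
    from its code onwards, hence to almost all stages along \<open>U\<close>.\<close>
  define cut where "cut \<Psi> n = {\<phi> \<in> \<Psi>. code \<phi> \<le> n}" for \<Psi> :: "('c, 'p) fm set" and n
  have fin_cut: "finite (cut \<Psi> n)" if "\<Psi> \<subseteq> Fm S" for \<Psi> n
  proof (rule inj_on_finite[of code _ "{..n}"])
    show "inj_on code (cut \<Psi> n)" using code that by (auto simp: cut_def intro: inj_on_subset)
  qed (auto simp: cut_def)
  \<comment> \<open>From stage \<open>k\<close> on a premise is present, if there is any, so the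
    countermodels used have designated values, as \<open>refuted_in_UP\<close> demands.\<close>
  obtain k where k: "\<Gamma> = {} \<or> (\<forall>n. cut \<Gamma> (k + n) \<noteq> {})"
  proof (cases "\<Gamma> = {}")
    case False
    then obtain \<gamma> where "\<gamma> \<in> \<Gamma>" by blast
    then have "\<gamma> \<in> cut \<Gamma> (code \<gamma> + n)" for n by (simp add: cut_def)
    then show thesis using that by blast
  qed (use that in blast)
  have "\<exists>(M :: ('c, 'a) nmatrix) v. M \<in> Nmatr S L \<and> valuation S M v \<and>
      (\<forall>\<phi>\<in>cut \<Gamma> n. v \<phi> \<in> desig M) \<and> (\<forall>\<phi>\<in>cut \<Delta> n. v \<phi> \<notin> desig M)" for n
  proof -
    have c: "cut \<Gamma> n \<subseteq> Fm S" "cut \<Delta> n \<subseteq> Fm S" using sub by (auto simp: cut_def)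
    moreover have "(cut \<Gamma> n, cut \<Delta> n) \<notin> L"
      by (rule no) (use fin_cut sub in \<open>auto simp: cut_def\<close>)
    ultimately obtain M :: "('c, 'a) nmatrix"
      where "M \<in> Nmatr S L" "(cut \<Gamma> n, cut \<Delta> n) \<notin> logic_of_nmatrix S M"
      using Nmatr_complete[OF L _ _ _ count inf(1)] by metis
    from this(1) not_in_logic_of_nmatrixE[OF this(2) c] show ?thesis by metis
  qed
  then obtain N :: "nat \<Rightarrow> ('c, 'a) nmatrix" and v where N: "\<And>n. N n \<in> Nmatr S L"
    and v: "\<And>n. valuation S (N n) (v n)"
    and v\<Gamma>: "\<And>n \<phi>. \<phi> \<in> cut \<Gamma> n \<Longrightarrow> v n \<phi> \<in> desig (N n)"
    and v\<Delta>: "\<And>n \<phi>. \<phi> \<in> cut \<Delta> n \<Longrightarrow> v n \<phi> \<notin> desig (N n)"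
    by metis
  define M where "M i = N (k + ix i)" for i
  interpret ultraproduct_family S J U M
    by unfold_locales (use U N in \<open>auto simp: Nmatr_def M_def\<close>)
  have late: "ae (\<lambda>i. m \<le> ix i)" for m using large by (simp add: ae_def)
  have "(\<Gamma>, \<Delta>) \<notin> logic_of_nmatrix S UP"
  proof (rule refuted_in_UP[where v = "\<lambda>i. v (k + ix i)"])
    show "ae (\<lambda>i. v (k + ix i) \<phi> \<in> desig (M i))" if "\<phi> \<in> \<Gamma>" for \<phi>
    proof (rule ae_mono[OF late[of "code \<phi>"]])
      fix i assume "code \<phi> \<le> ix i"
      then have "\<phi> \<in> cut \<Gamma> (k + ix i)" using that by (simp add: cut_def)
      then show "v (k + ix i) \<phi> \<in> desig (M i)" using v\<Gamma> by (auto simp: M_def)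
    qed
    show "ae (\<lambda>i. v (k + ix i) \<phi> \<notin> desig (M i))" if "\<phi> \<in> \<Delta>" for \<phi>
    proof (rule ae_mono[OF late[of "code \<phi>"]])
      fix i assume "code \<phi> \<le> ix i"
      then have "\<phi> \<in> cut \<Delta> (k + ix i)" using that by (simp add: cut_def)
      then show "v (k + ix i) \<phi> \<notin> desig (M i)" using v\<Delta> by (auto simp: M_def)
    qed
    show "\<Gamma> = {} \<or> (\<forall>i\<in>J. desig (M i) \<noteq> {})"
      using k v\<Gamma> unfolding M_def by blast
  qed (use v sub in \<open>auto simp: M_def\<close>)
  moreover have "UP \<in> Nmatr S L"
    by (rule closed_under_ultraproductsD[OF closed U]) (simp add: M_def N)
  ultimately show False using r unfolding Nmatr_def by blast
qed

lemma finitely_based_if_closed: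
  fixes S :: "nat \<Rightarrow> 'c set" and L :: "('c, 'p) mc_rule set"
  assumes count: "countable (Fm S :: ('c, 'p) fm set)"
    and inf: "infinite (UNIV :: 'a set)" "infinite (UNIV :: 'i set)"
    and L: "mc_logic S L"
    and closed: "closed_under_ultraproducts
      (Nmatr S L :: ('c, 'a) nmatrix set) (Nmatr S L :: ('c, ('i \<Rightarrow> 'a) set) nmatrix set)"
    and co_closed: "closed_under_ultraproducts
      (co_Nmatr S L :: ('c, 'a) nmatrix set) (co_Nmatr S L :: ('c, ('i \<Rightarrow> 'a) set) nmatrix set)"
  shows "finitely_based S L"
proof (rule ccontr)
  assume nfb: "\<not> finitely_based S L"
  define F where "F = {r \<in> L. finite_rule r}"
  have FL: "F \<subseteq> L" by (auto simp: F_def)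
  \<comment> \<open>By finitarity every rule of \<open>L\<close> is a dilution of a finite rule of
    \<open>L\<close>.\<close>
  have LF: "L = logic_of_rules S F"
  proof
    show "logic_of_rules S F \<subseteq> L" by (rule logic_of_rules_least[OF L FL])
    have ml: "mc_logic S (logic_of_rules S F)"
      by (rule mc_logic_logic_of_rules) (use FL mc_logic_subset[OF L] in blast)
    show "L \<subseteq> logic_of_rules S F"
    proof (rule subrelI)
      fix \<Gamma> \<Delta> assume r: "(\<Gamma>, \<Delta>) \<in> L"
      obtain \<Gamma>' \<Delta>' where *: "finite \<Gamma>'" "finite \<Delta>'" "\<Gamma>' \<subseteq> \<Gamma>" "\<Delta>' \<subseteq> \<Delta>" "(\<Gamma>', \<Delta>') \<in> L"
        using finitary_if_Nmatr_closed[OF count inf L closed r] by blast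
      then have "(\<Gamma>', \<Delta>') \<in> logic_of_rules S F"
        using rules_subset_logic_of_rules[of F S] by (auto simp: F_def finite_rule_def)
      then show "(\<Gamma>, \<Delta>) \<in> logic_of_rules S F"
        by (rule mc_logic_dilute[OF ml]) (use * r mc_logic_subset[OF L] in blast)+
    qed
  qed
  have "countable ({X. X \<subseteq> Fm S \<and> finite X} \<times> {X. X \<subseteq> Fm S \<and> finite X} :: ('c, 'p) mc_rule set)"
    using countable_Collect_finite_subset[OF count] by (intro countable_SIGMA) (simp_all add: conj_commute)
  then have countF: "countable F"
    by (rule countable_subset[rotated]) (use mc_logic_subset[OF L] in \<open>auto simp: F_def finite_rule_def\<close>)
  \<comment> \<open>A trivial rule makes \<open>F\<close> nonempty, so that a sequence can enumerate
    it.\<close>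
  have "({Var undefined}, {Var undefined}) \<in> F"
    unfolding F_def finite_rule_def
    using mc_logic_overlap[OF L, of "{Var undefined}" "{Var undefined}"] by (simp add: Fm.Var)
  then have "F \<noteq> {}" by blast
  then obtain \<rho> :: "nat \<Rightarrow> ('c, 'p) mc_rule" where \<rho>: "range \<rho> = F" using range_from_nat_into[OF _ countF] by blast
  \<comment> \<open>The first rules generate a logic strictly below \<open>L\<close>. Completeness
    of that smaller logic separates it from \<open>L\<close> by a model of these rules outside
    \<open>Nmatr S L\<close>.\<close>
  have "\<exists>M :: ('c, 'a) nmatrix. M \<in> co_Nmatr S L \<and> \<rho> ` {..n} \<subseteq> logic_of_nmatrix S M" for n
  proof -
    let ?R = "\<rho> ` {..n}"
    have RF: "?R \<subseteq> F" using \<rho> by blast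
    then have RP: "?R \<subseteq> Pow (Fm S) \<times> Pow (Fm S)" using FL mc_logic_subset[OF L] by blast
    have "L \<noteq> logic_of_rules S ?R"
      using nfb RP RF unfolding finitely_based_def F_def by blast
    moreover have "logic_of_rules S ?R \<subseteq> L" using logic_of_rules_least[OF L] RF FL by blast
    ultimately obtain \<Gamma> \<Delta> where r: "(\<Gamma>, \<Delta>) \<in> L" "(\<Gamma>, \<Delta>) \<notin> logic_of_rules S ?R" by auto
    moreover have "\<Gamma> \<subseteq> Fm S" "\<Delta> \<subseteq> Fm S" using r mc_logic_subset[OF L] by auto
    ultimately obtain M :: "('c, 'a) nmatrix"
      where M: "M \<in> Nmatr S (logic_of_rules S ?R)" "(\<Gamma>, \<Delta>) \<notin> logic_of_nmatrix S M"
      using Nmatr_complete[OF mc_logic_logic_of_rules[OF RP] _ _ _ count inf(1)] by metis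
    then have "M \<in> co_Nmatr S L" "?R \<subseteq> logic_of_nmatrix S M"
      using r(1) unfolding Nmatr_logic_of_rules by (auto simp: co_Nmatr_def Nmatr_def)
    then show ?thesis by blast
  qed
  then obtain N :: "nat \<Rightarrow> ('c, 'a) nmatrix" where N: "\<And>n. N n \<in> co_Nmatr S L"
    and N\<rho>: "\<And>n. \<rho> ` {..n} \<subseteq> logic_of_nmatrix S (N n)" by metis
  have N_val: "\<rho> j \<in> logic_of_nmatrix S (N n)" if "j \<le> n" for j n using N\<rho>[of n] that by blast
  obtain J :: "'i set" and U and ix :: "'i \<Rightarrow> nat"
    where U: "ultrafilter_on J U" and large: "\<And>k. {i \<in> J. k \<le> ix i} \<in> U"
    using sequence_ultrafilter_exists[OF inf(2)] by blast
  \<comment> \<open>Starting after a rule without premises, if there is one, keeps all \<open>desig (M i)\<close> nonempty.\<close>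
  obtain k where k: "fst (\<rho> k) = {} \<or> (\<forall>j. fst (\<rho> j) \<noteq> {})" by blast
  define M where "M i = N (k + ix i)" for i
  interpret ultraproduct_family S J U M
    by unfold_locales (use U N in \<open>auto simp: co_Nmatr_def M_def\<close>)
  have late: "ae (\<lambda>i. m \<le> ix i)" for m using large by (simp add: ae_def)
  \<comment> \<open>Lying outside \<open>Nmatr S L\<close>, \<open>M i\<close> has a valuation. It
    also validates \<open>\<rho> k\<close>, as \<open>k \<le> k + ix i\<close>; with no premises to
    satisfy, that valuation designates a conclusion.\<close>
  have desig_ne: "desig (M i) \<noteq> {}" if "fst (\<rho> k) = {}" "i \<in> J" for i
  proof -
    have "M i \<in> co_Nmatr S L" using N by (simp add: M_def)
    then obtain \<Gamma> \<Delta> where r: "(\<Gamma>, \<Delta>) \<in> L" "(\<Gamma>, \<Delta>) \<notin> logic_of_nmatrix S (M i)"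
      unfolding co_Nmatr_def Nmatr_def by auto
    then have "\<Gamma> \<subseteq> Fm S" "\<Delta> \<subseteq> Fm S" using mc_logic_subset[OF L] by auto
    with r(2) obtain v :: "('c, 'p) fm \<Rightarrow> 'a" where v: "valuation S (M i) v"
      by (rule not_in_logic_of_nmatrixE)
    have "(fst (\<rho> k), snd (\<rho> k)) \<in> logic_of_nmatrix S (M i)"
      using N_val[of k "k + ix i"] by (simp add: M_def)
    from logic_of_nmatrixD[OF this v] show ?thesis using that by auto
  qed
  have "F \<subseteq> logic_of_nmatrix S UP"
  proof
    fix r assume "r \<in> F"
    then obtain j where j: "r = \<rho> j" using \<rho> by blast
    have "(fst r, snd r) \<in> logic_of_nmatrix S UP"
    proof (rule finite_rule_valid_in_UP)
      show "finite (fst r)" "finite (snd r)" using \<open>r \<in> F\<close> by (auto simp: F_def finite_rule_def)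
      show "ae (\<lambda>i. (fst r, snd r) \<in> logic_of_nmatrix S (M i))"
        by (rule ae_mono[OF late[of j]]) (use N_val j in \<open>auto simp: M_def\<close>)
      show "fst r \<noteq> {} \<or> (\<forall>i\<in>J. desig (M i) \<noteq> {})" using k desig_ne j by blast
    qed
    then show "r \<in> logic_of_nmatrix S UP" by simp
  qed
  then have "UP \<in> Nmatr S L" using LF Nmatr_logic_of_rules nmatrix_UP by metis
  moreover have "UP \<in> co_Nmatr S L"
    by (rule closed_under_ultraproductsD[OF co_closed U]) (simp add: M_def N)
  ultimately show False unfolding co_Nmatr_def by blast
qed

text \<open>The infinite type \<open>'a\<close> accommodates the countable Lindenbaum matrices, and
  the infinite type \<open>'i\<close> the ultrafilters along sequences. Closure at these two types
  therefore already forces a finite base.\<close>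

theorem theorem31:
  fixes S :: "nat \<Rightarrow> 'c set"
    and L :: "('c, 'p) mc_rule set"
  assumes "\<forall>k. countable (S k)"
    and "countable (UNIV :: 'p set)"
    and "infinite (UNIV :: 'p set)"
    and "infinite (UNIV :: 'a set)"
    and "infinite (UNIV :: 'i set)"
    and "mc_logic S L"
  shows "finitely_based S L \<longleftrightarrow>
    closed_under_ultraproducts
      (Nmatr S L :: ('c, 'a) nmatrix set) (Nmatr S L :: ('c, ('i \<Rightarrow> 'a) set) nmatrix set) \<and>
    closed_under_ultraproducts
      (co_Nmatr S L :: ('c, 'a) nmatrix set) (co_Nmatr S L :: ('c, ('i \<Rightarrow> 'a) set) nmatrix set)"
  (is "_ \<longleftrightarrow> ?closed \<and> ?co_closed")
proof
  assume "finitely_based S L"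
  then obtain R where R: "R \<subseteq> Pow (Fm S) \<times> Pow (Fm S)" "finite R" "\<forall>r\<in>R. finite_rule r"
    "L = logic_of_rules S R" unfolding finitely_based_def by blast
  show "?closed \<and> ?co_closed"
    using Nmatr_closed_if_finitely_based[OF R(4,3)]
      co_Nmatr_closed_if_finitely_based[OF R(4,1,2)] by blast
next
  assume "?closed \<and> ?co_closed"
  then show "finitely_based S L"
    using finitely_based_if_closed[OF countable_Fm[OF assms(1,2)] assms(4,5,6)] by blast
qed

end
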